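(* Let $\mathcal X$ be a reflexive Banach space, let $\psi:\mathcal X\times\mathcal X^*\to[0,+\infty)$ be a self-dual kernel, and let $\mathsf G$ be a group of bounded linear isomorphisms of $\mathcal X\times\mathcal X^*$ of the form $\mathsf U(x,v)=(Ux,U'v)$ such that, for every $\mathsf U=(U,U')\in\mathsf G$ and every $(x,v)\in\mathcal X\times\mathcal X^*$, $$\langle U'v,Ux\rangle=\langle v,x\rangle,\qquad \psi(Ux,U'v)=\psi(x,v).$$ Let $A\subset\mathcal X\times\mathcal X^*$ be a nonempty $\mathsf G$-invariant monotone operator and let $D:=\overline{\mathrm{co}}(\mathrm D(A))$. Then the function $$f(x,v):=\mathsf f_A(x,v)+\mathrm I_{D\times\mathcal X^*}(x,v)$$ is $\mathsf G$-invariant. Moreover, defining $$R_f(x,v):=\min\Big\{\tfrac12 f(x_1,v_1)+\tfrac12 f^*(v_2,x_2)+\tfrac14\psi(x_1-x_2,v_1-v_2)\ :\ (x,v)=\tfrac12(x_1+x_2,v_1+v_2)\Big\}$$ and its contact set $\tilde A:=\{(x,v)\in\mathcal X\times\mathcal X^*:R_f(x,v)=\langle v,x\rangle\}$, the set $\tilde A$ is a $\mathsf G$-invariant maximal monotone extension of $A$ with domain included in $\overline{\mathrm{co}}(\mathrm D(A))$.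
   Context: $\mathcal X$ is a reflexive Banach space with dual $\mathcal X^*$ and duality pairing $\langle v,x\rangle$ ($v\in\mathcal X^*$, $x\in\mathcal X$). A multivalued operator is identified with its graph $A\subset\mathcal X\times\mathcal X^*$. It is monotone if $\langle v-w,x-y\rangle\ge0$ for all $(x,v),(y,w)\in A$; maximal monotone if it is monotone and every monotone subset of $\mathcal X\times\mathcal X^*$ containing it coincides with it. $\mathrm D(A)$ is the projection of $A$ on $\mathcal X$; $\overline{\mathrm{co}}$ denotes closed convex hull. A maximal monotone extension of $A$ is a maximal monotone operator containing $A$. $\mathrm I_C$ is the indicator function ($0$ on $C$, $+\infty$ outside). For a proper $g:\mathcal X\times\mathcal X^*\to(-\infty,+\infty]$, $g^*(v,x)=\sup_{(x_0,v_0)}\{\langle v_0,x\rangle+\langle v,x_0\rangle-g(x_0,v_0)\}$ for $(v,x)\in\mathcal X^*\times\mathcal X$; analogously for functions on $\mathcal X^*\times\mathcal X$. Set $\mathsf c_A(v,x):=\langle v,x\rangle$ if $(x,v)\in A$ and $+\infty$ otherwise, and $\mathsf f_A:=\mathsf c_A^*$, i.e. $\mathsf f_A(x,v)=\sup_{(x_0,v_0)\in A}\{\langle v_0,x\rangle+\langle v,x_0\rangle-\langle v_0,x_0\rangle\}$. A self-dual kernel is $\psi:\mathcal X\times\mathcal X^*\to[0,+\infty)$ with $\psi(-z)=\psi(z)$ for all $z$ and $\psi(x,v)=\psi^*(v,x)$ for all $(x,v)$. A set $A\subset\mathcal X\times\mathcal X^*$ is $\mathsf G$-invariant if $(Ux,U'v)\in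 A$ for every $(x,v)\in A$ and $(U,U')\in\mathsf G$. A function $g$ on $\mathcal X\times\mathcal X^*$ is $\mathsf G$-invariant if $g\circ\mathsf U=g$ for every $\mathsf U\in\mathsf G$. *)

theory Defs
  imports "HOL-Analysis.Analysis"
begin

type_synonym 'a dual = "'a \<Rightarrow>\<^sub>L real"

(* The canonical embedding of the space into its bidual is onto. *)
definition reflexive_space :: "'a::real_normed_vector itself \<Rightarrow> bool" where
  "reflexive_space _ \<longleftrightarrow>
     (\<forall>\<phi> :: 'a dual dual. \<exists>x :: 'a. \<forall>v :: 'a dual. blinfun_apply \<phi> v = blinfun_apply v x)"

abbreviation pairing :: "'a::real_normed_vector dual \<Rightarrow> 'a \<Rightarrow> real" where
  "pairing v x \<equiv> blinfun_apply v x"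

definition monotone_op :: "('a::real_normed_vector \<times> 'a dual) set \<Rightarrow> bool" where
  "monotone_op A \<longleftrightarrow> (\<forall>(x, v)\<in>A. \<forall>(y, w)\<in>A. pairing (v - w) (x - y) \<ge> 0)"

definition maximal_monotone_op :: "('a::real_normed_vector \<times> 'a dual) set \<Rightarrow> bool" where
  "maximal_monotone_op A \<longleftrightarrow>
     monotone_op A \<and> (\<forall>B. monotone_op B \<and> A \<subseteq> B \<longrightarrow> B = A)"

definition op_domain :: "('a::real_normed_vector \<times> 'a dual) set \<Rightarrow> 'a set" where
  "op_domain A = fst ` A"

definition closed_convex_hull :: "'a::real_normed_vector set \<Rightarrow> 'a set" where
  "closed_convex_hull S = closure (convex hull S)"

(* The indicator of convex analysis, unlike the 0/1-valued library indicator. *)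
definition convex_indicator :: "'b set \<Rightarrow> 'b \<Rightarrow> ereal" where
  "convex_indicator C z = (if z \<in> C then 0 else \<infinity>)"

(* Functions with values in (-\<infinity>, +\<infinity>] are modelled as ereal-valued. The conjugate of a function
   on X \<times> X* lives on X* \<times> X, and conversely for dual_conjugate. *)
definition conjugate :: "('a::real_normed_vector \<times> 'a dual \<Rightarrow> ereal) \<Rightarrow> 'a dual \<times> 'a \<Rightarrow> ereal" where
  "conjugate g = (\<lambda>(v, x). SUP (x0, v0)\<in>UNIV.
     ereal (pairing v0 x) + ereal (pairing v x0) - g (x0, v0))"

definition dual_conjugate :: "('a::real_normed_vector dual \<times> 'a \<Rightarrow> ereal) \<Rightarrow> 'a \<times> 'a dual \<Rightarrow> ereal" where
  "dual_conjugate h = (\<lambda>(x, v). SUP (v0, x0)\<in>UNIV.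
     ereal (pairing v0 x) + ereal (pairing v x0) - h (v0, x0))"

definition c_fun :: "('a::real_normed_vector \<times> 'a dual) set \<Rightarrow> 'a dual \<times> 'a \<Rightarrow> ereal" where
  "c_fun A = (\<lambda>(v, x). if (x, v) \<in> A then ereal (pairing v x) else \<infinity>)"

definition fitzpatrick :: "('a::real_normed_vector \<times> 'a dual) set \<Rightarrow> 'a \<times> 'a dual \<Rightarrow> ereal" where
  "fitzpatrick A = dual_conjugate (c_fun A)"

definition restricted_fitzpatrick ::
    "('a::real_normed_vector \<times> 'a dual) set \<Rightarrow> 'a \<times> 'a dual \<Rightarrow> ereal" where
  "restricted_fitzpatrick A z =
     fitzpatrick A z + convex_indicator (closed_convex_hull (op_domain A) \<times> UNIV) z"

definition self_dual_kernel :: "('a::real_normed_vector \<times> 'a dual \<Rightarrow> real) \<Rightarrow> bool" where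
  "self_dual_kernel \<psi> \<longleftrightarrow>
     (\<forall>z. \<psi> z \<ge> 0) \<and> (\<forall>z. \<psi> (- z) = \<psi> z) \<and>
     (\<forall>x v. ereal (\<psi> (x, v)) = conjugate (\<lambda>z. ereal (\<psi> z)) (v, x))"

definition kernel_average_values ::
    "('a::real_normed_vector \<times> 'a dual \<Rightarrow> real) \<Rightarrow> ('a \<times> 'a dual \<Rightarrow> ereal)
       \<Rightarrow> 'a \<times> 'a dual \<Rightarrow> ereal set" where
  "kernel_average_values \<psi> f z =
     {ereal (1/2) * f (x1, v1) + ereal (1/2) * conjugate f (v2, x2)
        + ereal (1/4 * \<psi> (x1 - x2, v1 - v2)) | x1 v1 x2 v2.
        z = (1/2) *\<^sub>R (x1 + x2, v1 + v2)}"

(* Defined as an infimum; it is the minimum exactly when it belongs to the set of values. *)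
definition kernel_average ::
    "('a::real_normed_vector \<times> 'a dual \<Rightarrow> real) \<Rightarrow> ('a \<times> 'a dual \<Rightarrow> ereal)
       \<Rightarrow> 'a \<times> 'a dual \<Rightarrow> ereal" where
  "kernel_average \<psi> f z = Inf (kernel_average_values \<psi> f z)"

definition contact_set :: "('a::real_normed_vector \<times> 'a dual \<Rightarrow> ereal) \<Rightarrow> ('a \<times> 'a dual) set" where
  "contact_set R = {(x, v). R (x, v) = ereal (pairing v x)}"

(* Boundedness of the inverses is implied by closure of the group under inv. *)
definition bounded_linear_iso_group :: "('b::real_normed_vector \<Rightarrow> 'b) set \<Rightarrow> bool" where
  "bounded_linear_iso_group G \<longleftrightarrow>
     (\<forall>T\<in>G. bounded_linear T \<and> bij T) \<and>
     id \<in> G \<and> (\<forall>S\<in>G. \<forall>T\<in>G. S \<circ> T \<in> G) \<and> (\<forall>T\<in>G. inv T \<in> G)"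

definition invariant_set :: "('b \<Rightarrow> 'b) set \<Rightarrow> 'b set \<Rightarrow> bool" where
  "invariant_set G A \<longleftrightarrow> (\<forall>T\<in>G. \<forall>z\<in>A. T z \<in> A)"

definition invariant_fun :: "('b \<Rightarrow> 'b) set \<Rightarrow> ('b \<Rightarrow> 'c) \<Rightarrow> bool" where
  "invariant_fun G g \<longleftrightarrow> (\<forall>T\<in>G. g \<circ> T = g)"

end

theory Submission
  imports Defs
begin

text \<open>
  The product \<open>Z = X \<times> X*\<close> carries the symmetric form \<open>b((x, v), (y, w)) = \<langle>v, y\<rangle> + \<langle>w, x\<rangle>\<close>, whose
  quadratic form \<open>q = b(z, z) / 2\<close> is the duality pairing. Because \<open>X\<close> is reflexive, every continuous
  functional on \<open>Z\<close> is \<open>b(w, -)\<close> for some \<open>w\<close>, so that conjugation becomes an operation on functions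
  on \<open>Z\<close> itself. It is convenient to encode an extended-valued function by its epigraph
  in \<open>Z \<times> \<real>\<close>: the epigraph of the conjugate is then the set \<open>polar_epi\<close> of all \<open>(z, r)\<close> with
  \<open>b(z, w) \<le> r + s\<close> for every \<open>(w, s)\<close> in the original epigraph, and infinities do not appear.

  The proof has three ingredients.

  \<^item> If \<open>K\<close> is the epigraph of a self-conjugate function, then its contact set \<open>{z. (z, q z) \<in> K}\<close> is
  maximal monotone. Monotonicity is Fenchel's inequality. For maximality, translate a point
  \<open>z0\<close> monotonically related to the contact set to the origin and separate \<open>K\<close> from the concave
  function \<open>-|z|^2 / 2\<close>; the separating functional, represented as \<open>b(p, -)\<close>, yields a contact point
  \<open>z0 + p\<close> with \<open>q p = -|p|^2 / 2\<close>, and the monotone relation forces \<open>p = 0\<close> (\<open>contact_maximal\<close>).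

  \<^item> The average of a function \<open>f\<close> and its conjugate \<open>f*\<close> through a self-dual kernel is self-conjugate as soon as
  \<open>f\<close> is convex, \<open>f\<close> and \<open>f*\<close> are proper, and \<open>f** \<ge> f\<close> (\<open>average_epi_self_polar\<close>).
  One inequality is Young's, applied to the three summands. The other is Fenchel duality for the sum of
  \<open>f(z1) + f*(z2)\<close> and a multiple of \<open>\<psi>(z1 - z2)\<close>: the dual problem has the same form as the original
  one, and it is attained. This is also why the infimum defining the average is a minimum.

  \<^item> The restricted Fitzpatrick function \<open>f\<close> fulfils these requirements and, moreover, \<open>f*\<close> is finite only
  over \<open>D\<close>, the closed convex hull of the domain of \<open>A\<close>. Both facts come from tilting:
  if a functional \<open>\<phi>\<close> is at most \<open>s\<close> on \<open>D\<close>, then for \<open>a \<in> A\<close> and \<open>t \<ge> 0\<close> the point \<open>(a + (0, t \<phi>), q a + t s)\<close> lies in the epigraphs of \<open>f\<close> and of \<open>f*\<close>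
  (\<open>tilted_graph_mem\<close>). A contact point is the midpoint of a point where \<open>f\<close> is finite and one where \<open>f*\<close> is finite,
  so its first component lies in \<open>D\<close>.

  All separation arguments come from one analytic form of the Hahn--Banach theorem, \<open>sandwich\<close>, which
  places an affine function between a convex set of points and a finite concave function.
  Invariance is inherited at each stage, because every construction is expressed through \<open>b\<close>, \<open>\<psi>\<close>
  and \<open>A\<close>, which the group preserves.
\<close>

section \<open>The Hahn--Banach theorem for sublinear functions\<close>

definition sublinear :: "('a::real_vector \<Rightarrow> real) \<Rightarrow> bool" where
  "sublinear p \<longleftrightarrow> (\<forall>x y. p (x + y) \<le> p x + p y) \<and> (\<forall>t x. 0 < t \<longrightarrow> p (t *\<^sub>R x) = t * p x)"

lemma sublinear_zero: "sublinear p \<Longrightarrow> p 0 = 0"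
  unfolding sublinear_def by (metis scaleR_zero_right mult_cancel_right1 numeral_eq_one_iff semiring_norm(85) zero_less_numeral)

lemma sublinear_lower: "sublinear p \<Longrightarrow> - p (- x) \<le> p x"
  using sublinear_zero[of p] unfolding sublinear_def by (metis add.right_inverse neg_le_iff_le diff_0 diff_le_eq add.commute)

lemma sublinear_scale_nonneg: "sublinear p \<Longrightarrow> 0 \<le> t \<Longrightarrow> p (t *\<^sub>R x) = t * p x"
  using sublinear_zero[of p] unfolding sublinear_def by (cases "t = 0") auto

text \<open>
  For fixed \<open>y\<close>, the function \<open>u \<mapsto> inf {p (u + t y) - t p y | t \<ge> 0}\<close> is again sublinear and below \<open>p\<close>.
  Minimality makes it equal to \<open>p\<close>, and comparing with the value at \<open>t = 1\<close> shows that \<open>p\<close> is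
  superadditive as well.
\<close>

lemma minimal_sublinear_linear:
  fixes p :: "'a::real_vector \<Rightarrow> real"
  assumes p: "sublinear p" and min: "\<And>q. sublinear q \<Longrightarrow> q \<le> p \<Longrightarrow> q = p"
  shows "linear p"
proof -
  have super: "p u + p y \<le> p (u + y)" for u y
  proof -
    define V where "V u = (\<lambda>t. p (u + t *\<^sub>R y) - t * p y) ` {0..}" for u
    define k where "k u = Inf (V u)" for u
    have V_lower: "- p (- u) \<le> c" if "c \<in> V u" for c u
    proof -
      obtain t where t: "0 \<le> t" "c = p (u + t *\<^sub>R y) - t * p y" using \<open>c \<in> V u\<close> by (auto simp: V_def)
      have "t * p y = p ((u + t *\<^sub>R y) + (- u))" using sublinear_scale_nonneg[OF p t(1)] by simp
      also have "\<dots> \<le> p (u + t *\<^sub>R y) + p (- u)" using p unfolding sublinear_def by blast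
      finally show ?thesis using t by simp
    qed
    have bdd: "bdd_below (V u)" for u using V_lower by (rule bdd_belowI)
    have ne: "V u \<noteq> {}" for u by (auto simp: V_def)
    have k_le: "k u \<le> p (u + t *\<^sub>R y) - t * p y" if "0 \<le> t" for t u
      unfolding k_def by (rule cInf_lower[OF _ bdd]) (use that in \<open>auto simp: V_def\<close>)
    have k_ge: "m \<le> k u" if "\<And>t. 0 \<le> t \<Longrightarrow> m \<le> p (u + t *\<^sub>R y) - t * p y" for m u
      unfolding k_def by (rule cInf_greatest[OF ne]) (use that in \<open>auto simp: V_def\<close>)
    have scale_le: "k (s *\<^sub>R u) \<le> s * k u" if "0 < s" for s u
    proof -
      have "k (s *\<^sub>R u) / s \<le> k u"
      proof (rule k_ge)
        fix t :: real assume t: "0 \<le> t"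
        have "k (s *\<^sub>R u) \<le> p (s *\<^sub>R u + (s * t) *\<^sub>R y) - (s * t) * p y" using t that by (intro k_le) auto
        also have "s *\<^sub>R u + (s * t) *\<^sub>R y = s *\<^sub>R (u + t *\<^sub>R y)" by (simp add: algebra_simps)
        also have "p \<dots> = s * p (u + t *\<^sub>R y)" using p that unfolding sublinear_def by blast
        finally show "k (s *\<^sub>R u) / s \<le> p (u + t *\<^sub>R y) - t * p y" using that by (simp add: field_simps)
      qed
      then show ?thesis using that by (simp add: field_simps)
    qed
    have "sublinear k" unfolding sublinear_def
    proof (intro conjI allI impI)
      fix v w
      have "k (v + w) - k w \<le> k v"
      proof (rule k_ge)
        fix t :: real assume t: "0 \<le> t"
        have "k (v + w) - (p (v + t *\<^sub>R y) - t * p y) \<le> k w"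
        proof (rule k_ge)
          fix s :: real assume s: "0 \<le> s"
          have "k (v + w) \<le> p ((v + w) + (t + s) *\<^sub>R y) - (t + s) * p y" using t s by (intro k_le) auto
          also have "(v + w) + (t + s) *\<^sub>R y = (v + t *\<^sub>R y) + (w + s *\<^sub>R y)" by (simp add: algebra_simps)
          also have "p \<dots> \<le> p (v + t *\<^sub>R y) + p (w + s *\<^sub>R y)" using p unfolding sublinear_def by blast
          finally show "k (v + w) - (p (v + t *\<^sub>R y) - t * p y) \<le> p (w + s *\<^sub>R y) - s * p y" by (simp add: algebra_simps)
        qed
        then show "k (v + w) - k w \<le> p (v + t *\<^sub>R y) - t * p y" by simp
      qed
      then show "k (v + w) \<le> k v + k w" by simp
    next
      fix s :: real and u assume s: "0 < s"
      have "k ((1 / s) *\<^sub>R (s *\<^sub>R u)) \<le> (1 / s) * k (s *\<^sub>R u)" using s by (intro scale_le) auto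
      then have "s * k u \<le> k (s *\<^sub>R u)" using s by (simp add: field_simps)
      then show "k (s *\<^sub>R u) = s * k u" using scale_le[OF s, of u] by simp
    qed
    moreover have "k \<le> p" using k_le[of 0] by (auto simp: le_fun_def)
    ultimately have "k = p" by (rule min)
    then show "p u + p y \<le> p (u + y)" using k_le[of 1 u] by simp
  qed
  have add: "p (u + y) = p u + p y" for u y
    using super[of u y] p unfolding sublinear_def by (simp add: order_antisym)
  have neg: "p (- u) = - p u" for u using add[of u "- u"] sublinear_zero[OF p] by simp
  show ?thesis
  proof (rule linearI)
    fix t :: real and u
    show "p (t *\<^sub>R u) = t *\<^sub>R p u"
    proof (cases "0 \<le> t")
      case True then show ?thesis using sublinear_scale_nonneg[OF p] by simp
    next
      case False
      then have "p (- ((- t) *\<^sub>R u)) = - ((- t) * p u)" using sublinear_scale_nonneg[OF p, of "- t" u] neg by simp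
      then show ?thesis by simp
    qed
  qed (rule add)
qed

text \<open>
  Zorn's lemma is applied to the sublinear functions below \<open>p\<close>, ordered downwards, instead of to
  partial linear functionals: no subspaces are needed, and a minimal element is linear. Pointwise
  infima of chains stay finite because a sublinear \<open>q \<le> p\<close> satisfies \<open>q u \<ge> - p (- u)\<close>.
\<close>

theorem hahn_banach_sublinear:
  fixes p :: "'a::real_vector \<Rightarrow> real"
  assumes p: "sublinear p"
  obtains \<phi> where "linear \<phi>" "\<And>x. \<phi> x \<le> p x"
proof -
  define \<Q> where "\<Q> = {q. sublinear q \<and> q \<le> p}"
  have "\<exists>m\<in>\<Q>. \<forall>a\<in>\<Q>. a \<le> m \<longrightarrow> a = m"
  proof (rule predicate_Zorn)
    show "partial_order_on \<Q> (relation_of (\<lambda>m a. a \<le> m) \<Q>)"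
      by (rule partial_order_on_relation_ofI) auto
  next
    fix C assume "C \<in> Chains (relation_of (\<lambda>m a. a \<le> m) \<Q>)"
    then have CQ: "\<And>q. q \<in> C \<Longrightarrow> q \<in> \<Q>"
      and tot: "\<And>q r. q \<in> C \<Longrightarrow> r \<in> C \<Longrightarrow> q \<le> r \<or> r \<le> q"
      unfolding Chains_def relation_of_def by blast+
    show "\<exists>u\<in>\<Q>. \<forall>a\<in>C. u \<le> a"
    proof (cases "C = {}")
      case True then show ?thesis using p by (auto simp: \<Q>_def)
    next
      case False
      define k where "k u = Inf ((\<lambda>q. q u) ` C)" for u
      have bdd: "bdd_below ((\<lambda>q. q u) ` C)" for u
      proof (rule bdd_belowI2)
        fix q assume "q \<in> C"
        then have "sublinear q" "q (- u) \<le> p (- u)" using CQ by (auto simp: \<Q>_def le_fun_def)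
        then show "- p (- u) \<le> q u" using sublinear_lower[of q u] by linarith
      qed
      have k_le: "k u \<le> q u" if "q \<in> C" for q u
        unfolding k_def by (rule cINF_lower[OF bdd that])
      have k_ge: "m \<le> k u" if "\<And>q. q \<in> C \<Longrightarrow> m \<le> q u" for m u
        unfolding k_def by (rule cINF_greatest[OF False that])
      have "sublinear k" unfolding sublinear_def
      proof (intro conjI allI impI)
        fix v w
        have "k (v + w) - k w \<le> k v"
        proof (rule k_ge)
          fix q assume q: "q \<in> C"
          have "k (v + w) - q v \<le> k w"
          proof (rule k_ge)
            fix r assume r: "r \<in> C"
            obtain m where m: "m \<in> C" "m \<le> q" "m \<le> r" using tot[OF q r] q r by blast
            have "k (v + w) \<le> m (v + w)" by (rule k_le[OF m(1)])
            also have "\<dots> \<le> m v + m w" using CQ[OF m(1)] by (auto simp: \<Q>_def sublinear_def)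
            also have "\<dots> \<le> q v + r w" using m by (auto simp: le_fun_def intro: add_mono)
            finally show "k (v + w) - q v \<le> r w" by simp
          qed
          then show "k (v + w) - k w \<le> q v" by simp
        qed
        then show "k (v + w) \<le> k v + k w" by simp
      next
        fix s :: real and u assume s: "0 < s"
        have hom: "q (s *\<^sub>R u) = s * q u" if "q \<in> C" for q
          using CQ[OF that] s by (auto simp: \<Q>_def sublinear_def)
        have "k (s *\<^sub>R u) / s \<le> k u"
          by (rule k_ge) (use k_le[of _ "s *\<^sub>R u"] hom s in \<open>auto simp: field_simps\<close>)
        moreover have "s * k u \<le> k (s *\<^sub>R u)"
        proof (rule k_ge)
          fix q assume q: "q \<in> C"
          show "s * k u \<le> q (s *\<^sub>R u)"
            unfolding hom[OF q] using k_le[OF q, of u] s by simp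
        qed
        ultimately show "k (s *\<^sub>R u) = s * k u" using s by (simp add: field_simps)
      qed
      moreover obtain q where "q \<in> C" using False by blast
      then have "k \<le> p" using k_le[of q] CQ[of q] by (fastforce simp: \<Q>_def le_fun_def intro: order_trans)
      ultimately show ?thesis using k_le by (auto simp: \<Q>_def le_fun_def)
    qed
  qed
  then obtain m where m: "sublinear m" "m \<le> p" "\<And>a. sublinear a \<Longrightarrow> a \<le> p \<Longrightarrow> a \<le> m \<Longrightarrow> a = m"
    by (auto simp: \<Q>_def)
  then have "linear m" by (intro minimal_sublinear_linear) (auto intro: order_trans)
  with m show ?thesis using that by (auto simp: le_fun_def)
qed

section \<open>Separation by affine functions\<close>

text \<open>
  A separating functional \<open>\<phi>\<close> has to satisfy \<open>\<phi> (s - y) \<le> r + g y\<close> for all \<open>(s, r) \<in> S\<close> and all \<open>y\<close>, and \<open>c\<close> is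
  then the largest constant allowed by \<open>S\<close>. Writing \<open>y = s - t u\<close>, this says that \<open>\<phi>\<close> lies below
  \<open>p u = inf {(r + g (s - t u)) / t}\<close>. Convexity of \<open>S\<close> and of \<open>g\<close> makes \<open>p\<close> sublinear, and the
  hypothesis \<open>- g s \<le> r\<close> keeps it finite. As \<open>g\<close> is finite everywhere, no topology enters so far; the local upper
  bound on \<open>g\<close> serves only to make \<open>\<phi>\<close> continuous.
\<close>

theorem sandwich:
  fixes g :: "'a::real_normed_vector \<Rightarrow> real" and S :: "('a \<times> real) set"
  assumes S: "convex S" "S \<noteq> {}" and g: "convex_on UNIV g"
    and above: "\<And>s r. (s, r) \<in> S \<Longrightarrow> - g s \<le> r"
    and bounded: "0 < \<delta>" "\<And>y. y \<in> ball y0 \<delta> \<Longrightarrow> g y \<le> M"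
  obtains \<phi> :: "'a \<Rightarrow>\<^sub>L real" and c :: real where
    "\<And>s r. (s, r) \<in> S \<Longrightarrow> \<phi> s + c \<le> r" "\<And>y. - g y \<le> \<phi> y + c"
proof -
  define V where "V u = {(r + g (s - t *\<^sub>R u)) / t | s r t. (s, r) \<in> S \<and> 0 < t}" for u
  define p where "p u = Inf (V u)" for u
  obtain s0 r0 where s0: "(s0, r0) \<in> S" using S(2) by auto
  have ne: "V u \<noteq> {}" for u
    using s0 zero_less_one unfolding V_def by blast
  \<comment> \<open>the weights are chosen so that both steps \<open>t u\<close> and \<open>t' u'\<close> are scaled to the same length \<open>\<tau>\<close>\<close>
  have combine: "\<exists>s'' r''. (s'', r'') \<in> S \<and>
      (r'' + g (s'' - ((t * t') / (t + t')) *\<^sub>R (u + u'))) / ((t * t') / (t + t'))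
        \<le> (r + g (s - t *\<^sub>R u)) / t + (r' + g (s' - t' *\<^sub>R u')) / t'"
    if "(s, r) \<in> S" "(s', r') \<in> S" "0 < t" "0 < t'" for s r s' r' t t' u u'
  proof -
    define l where "l = t' / (t + t')"
    define l' where "l' = t / (t + t')"
    have l: "0 \<le> l" "0 \<le> l'" "l + l' = 1" using that by (auto simp: l_def l'_def add_divide_distrib[symmetric])
    define \<tau> where "\<tau> = (t * t') / (t + t')"
    have \<tau>: "0 < \<tau>" "l * t = \<tau>" "l' * t' = \<tau>" "l / \<tau> = 1 / t" "l' / \<tau> = 1 / t'"
      using that add_pos_pos[OF that(3,4)] by (auto simp: \<tau>_def l_def l'_def)
    have mem: "(l *\<^sub>R s + l' *\<^sub>R s', l * r + l' * r') \<in> S"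
      using convexD[OF S(1) that(1,2) l] by simp
    have pt: "l *\<^sub>R (s - t *\<^sub>R u) + l' *\<^sub>R (s' - t' *\<^sub>R u') = (l *\<^sub>R s + l' *\<^sub>R s') - \<tau> *\<^sub>R (u + u')"
      using \<tau> by (simp add: algebra_simps)
    have "g (l *\<^sub>R (s - t *\<^sub>R u) + l' *\<^sub>R (s' - t' *\<^sub>R u')) \<le> l * g (s - t *\<^sub>R u) + l' * g (s' - t' *\<^sub>R u')"
      using g l unfolding convex_on_def by auto
    then have "(l * r + l' * r') + g ((l *\<^sub>R s + l' *\<^sub>R s') - \<tau> *\<^sub>R (u + u'))
        \<le> l * (r + g (s - t *\<^sub>R u)) + l' * (r' + g (s' - t' *\<^sub>R u'))"
      unfolding pt by (simp add: algebra_simps)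
    then have "((l * r + l' * r') + g ((l *\<^sub>R s + l' *\<^sub>R s') - \<tau> *\<^sub>R (u + u'))) / \<tau>
        \<le> (l * (r + g (s - t *\<^sub>R u)) + l' * (r' + g (s' - t' *\<^sub>R u'))) / \<tau>"
      using \<tau>(1) by (intro divide_right_mono) auto
    also have "\<dots> = (l / \<tau>) * (r + g (s - t *\<^sub>R u)) + (l' / \<tau>) * (r' + g (s' - t' *\<^sub>R u'))"
      by (simp add: add_divide_distrib)
    also have "\<dots> = (r + g (s - t *\<^sub>R u)) / t + (r' + g (s' - t' *\<^sub>R u')) / t'"
      unfolding \<tau>(4,5) by simp
    finally show ?thesis using mem unfolding \<tau>_def[symmetric] by blast
  qed
  \<comment> \<open>for opposite directions the combined point is \<open>s''\<close> itself, where \<open>r'' + g s'' \<ge> 0\<close>\<close>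
  have pair_nonneg: "0 \<le> a + a'" if "a \<in> V u" "a' \<in> V (- u)" for a a' u
  proof -
    obtain s r t where 1: "(s, r) \<in> S" "0 < t" "a = (r + g (s - t *\<^sub>R u)) / t"
      using \<open>a \<in> V u\<close> unfolding V_def by blast
    obtain s' r' t' where 2: "(s', r') \<in> S" "0 < t'" "a' = (r' + g (s' - t' *\<^sub>R (- u))) / t'"
      using \<open>a' \<in> V (- u)\<close> unfolding V_def by blast
    obtain s'' r'' where 3: "(s'', r'') \<in> S"
      "(r'' + g (s'' - ((t * t') / (t + t')) *\<^sub>R (u + - u))) / ((t * t') / (t + t')) \<le> a + a'"
      using combine[OF 1(1) 2(1) 1(2) 2(2), of u "- u"] unfolding 1(3) 2(3) by blast
    have "0 \<le> (r'' + g (s'' - ((t * t') / (t + t')) *\<^sub>R (u + - u))) / ((t * t') / (t + t'))"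
      using above[OF 3(1)] 1 2 by (intro divide_nonneg_nonneg) auto
    then show ?thesis using 3 by linarith
  qed
  have bdd: "bdd_below (V u)" for u
  proof -
    obtain a' where "a' \<in> V (- u)" using ne by blast
    then show ?thesis using pair_nonneg[of _ u a'] by (intro bdd_belowI[of _ "- a'"]) (fastforce)
  qed
  have p_le: "p u \<le> (r + g (s - t *\<^sub>R u)) / t" if "(s, r) \<in> S" "0 < t" for s r t u
    unfolding p_def by (rule cInf_lower[OF _ bdd]) (use that in \<open>auto simp: V_def\<close>)
  have p_ge: "m \<le> p u" if "\<And>s r t. (s, r) \<in> S \<Longrightarrow> 0 < t \<Longrightarrow> m \<le> (r + g (s - t *\<^sub>R u)) / t" for m u
    unfolding p_def by (rule cInf_greatest[OF ne]) (use that in \<open>auto simp: V_def\<close>)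
  have scale_le: "p (a *\<^sub>R u) \<le> a * p u" if "0 < a" for a u
  proof -
    have "p (a *\<^sub>R u) / a \<le> p u"
    proof (rule p_ge)
      fix s r t assume "(s, r) \<in> S" "0 < (t::real)"
      then show "p (a *\<^sub>R u) / a \<le> (r + g (s - t *\<^sub>R u)) / t"
        using p_le[of s r "t / a" "a *\<^sub>R u"] that by (simp add: field_simps)
    qed
    then show ?thesis using that by (simp add: field_simps)
  qed
  have "sublinear p" unfolding sublinear_def
  proof (intro conjI allI impI)
    fix u u'
    have "p (u + u') - p u' \<le> p u"
    proof (rule p_ge)
      fix s r t assume 1: "(s, r) \<in> S" "0 < (t::real)"
      have "p (u + u') - (r + g (s - t *\<^sub>R u)) / t \<le> p u'"
      proof (rule p_ge)
        fix s' r' t' assume 2: "(s', r') \<in> S" "0 < (t'::real)"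
        obtain s'' r'' where 3: "(s'', r'') \<in> S"
          "(r'' + g (s'' - ((t * t') / (t + t')) *\<^sub>R (u + u'))) / ((t * t') / (t + t'))
             \<le> (r + g (s - t *\<^sub>R u)) / t + (r' + g (s' - t' *\<^sub>R u')) / t'"
          using combine[OF 1(1) 2(1) 1(2) 2(2)] by blast
        have "p (u + u') \<le> (r'' + g (s'' - ((t * t') / (t + t')) *\<^sub>R (u + u'))) / ((t * t') / (t + t'))"
          using 1 2 by (intro p_le 3(1)) auto
        then show "p (u + u') - (r + g (s - t *\<^sub>R u)) / t \<le> (r' + g (s' - t' *\<^sub>R u')) / t'"
          using 3 by linarith
      qed
      then show "p (u + u') - p u' \<le> (r + g (s - t *\<^sub>R u)) / t" by linarith
    qed
    then show "p (u + u') \<le> p u + p u'" by simp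
  next
    fix a :: real and u assume a: "0 < a"
    have "p ((1 / a) *\<^sub>R (a *\<^sub>R u)) \<le> (1 / a) * p (a *\<^sub>R u)" using a by (intro scale_le) auto
    then have "a * p u \<le> p (a *\<^sub>R u)" using a by (simp add: field_simps)
    then show "p (a *\<^sub>R u) = a * p u" using scale_le[OF a, of u] by simp
  qed
  then obtain \<phi> where \<phi>: "linear \<phi>" "\<And>u. \<phi> u \<le> p u" by (rule hahn_banach_sublinear) blast
  have sep: "\<phi> s - \<phi> y \<le> r + g y" if "(s, r) \<in> S" for s r y
  proof -
    have "\<phi> (s - y) \<le> p (s - y)" by (rule \<phi>)
    also have "\<dots> \<le> (r + g (s - 1 *\<^sub>R (s - y))) / 1" by (rule p_le[OF that]) simp
    finally show ?thesis using linear_diff[OF \<phi>(1)] by simp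
  qed
  define c where "c = Inf ((\<lambda>(s, r). r - \<phi> s) ` S)"
  have "bdd_below ((\<lambda>(s, r). r - \<phi> s) ` S)"
    using sep[of _ _ 0] linear_0[OF \<phi>(1)] by (intro bdd_belowI2[of _ "- g 0"]) (fastforce simp: split: prod.splits)
  then have c_le: "\<phi> s + c \<le> r" if "(s, r) \<in> S" for s r
    using cINF_lower[OF _ that, of "\<lambda>(s, r). r - \<phi> s"] unfolding c_def by fastforce
  have c_ge: "- g y \<le> \<phi> y + c" for y
  proof -
    have "- g y - \<phi> y \<le> c" unfolding c_def
      by (rule cINF_greatest[OF S(2)]) (use sep[of _ _ y] in fastforce)
    then show ?thesis by linarith
  qed
  have "\<exists>K. \<forall>x. norm (\<phi> x) \<le> norm x * K"
  proof (intro exI allI)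
    fix x
    define C where "C = max 0 (M + c + \<phi> y0)"
    have half: "- \<phi> z \<le> 2 * C / \<delta> * norm z" for z
    proof (cases "z = 0")
      case True then show ?thesis using linear_0[OF \<phi>(1)] by simp
    next
      case False
      define k where "k = \<delta> / (2 * norm z)"
      have k: "0 < k" using False bounded(1) by (simp add: k_def)
      have "y0 + k *\<^sub>R z \<in> ball y0 \<delta>" using False bounded(1) by (simp add: dist_norm k_def)
      then have "- M \<le> \<phi> (y0 + k *\<^sub>R z) + c" using bounded(2) c_ge order_trans neg_le_iff_le by metis
      then have "- \<phi> z * k \<le> C" using linear_add[OF \<phi>(1)] linear_scale[OF \<phi>(1)] by (simp add: C_def algebra_simps)
      then have "- \<phi> z \<le> C / k" using k by (simp add: pos_le_divide_eq)
      then show ?thesis by (simp add: k_def mult_ac)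
    qed
    have "- \<phi> (- x) = \<phi> x" using linear_neg[OF \<phi>(1)] by simp
    then show "norm (\<phi> x) \<le> norm x * (2 * C / \<delta>)" using half[of x] half[of "- x"] by (simp add: mult.commute abs_le_iff)
  qed
  then have "bounded_linear \<phi>" using \<phi>(1) by (simp add: bounded_linear_def bounded_linear_axioms_def)
  then show ?thesis using that[of "Blinfun \<phi>" c] c_le c_ge by (simp add: bounded_linear_Blinfun_apply)
qed

lemma convex_on_norm_UNIV: "convex_on UNIV (norm :: 'a::real_normed_vector \<Rightarrow> real)"
  using convex_on_dist[of UNIV 0] by (simp add: dist_norm)

lemma convex_on_norm_squared: "convex_on UNIV (\<lambda>y :: 'a::real_normed_vector. (norm y)\<^sup>2)"
proof (rule convex_onI)
  fix t :: real and x y :: 'a assume t: "0 < t" "t < 1"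
  have "norm ((1 - t) *\<^sub>R x + t *\<^sub>R y) \<le> (1 - t) * norm x + t * norm y"
    using norm_triangle_ineq[of "(1 - t) *\<^sub>R x" "t *\<^sub>R y"] t by simp
  then have "(norm ((1 - t) *\<^sub>R x + t *\<^sub>R y))\<^sup>2 \<le> ((1 - t) * norm x + t * norm y)\<^sup>2"
    by (intro power_mono) auto
  also have "\<dots> = (1 - t) * (norm x)\<^sup>2 + t * (norm y)\<^sup>2 - t * (1 - t) * (norm x - norm y)\<^sup>2"
    by (simp add: power2_eq_square algebra_simps)
  also have "\<dots> \<le> (1 - t) * (norm x)\<^sup>2 + t * (norm y)\<^sup>2" using t by simp
  finally show "(norm ((1 - t) *\<^sub>R x + t *\<^sub>R y))\<^sup>2 \<le> (1 - t) * (norm x)\<^sup>2 + t * (norm y)\<^sup>2" .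
qed simp

text \<open>
  The set \<open>S\<close> is the single point \<open>(- x, - norm x)\<close>, which lies on the graph of the concave function
  \<open>- norm\<close>. The affine function touches \<open>- norm\<close> there; homogeneity of the norm removes its constant.
\<close>

corollary norming_functional:
  fixes x :: "'a::real_normed_vector"
  obtains \<phi> :: "'a \<Rightarrow>\<^sub>L real" where "norm \<phi> \<le> 1" "\<phi> x = norm x"
proof -
  obtain \<phi> :: "'a \<Rightarrow>\<^sub>L real" and c where \<phi>: "\<And>s r. (s, r) \<in> {(- x, - norm x)} \<Longrightarrow> \<phi> s + c \<le> r"
    "\<And>y. - norm y \<le> \<phi> y + c"
    by (rule sandwich[of "{(- x, - norm x)}" norm 1 0 1]) (auto intro: convex_on_norm_UNIV less_imp_le)
  have c: "0 \<le> c" using \<phi>(2)[of 0] by (simp add: blinfun.zero_right)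
  \<comment> \<open>otherwise the gap at \<open>t y\<close> would grow linearly in \<open>t\<close> and exceed \<open>c\<close>\<close>
  have lower: "- norm y \<le> \<phi> y" for y
  proof (rule ccontr)
    assume "\<not> - norm y \<le> \<phi> y"
    then have pos: "0 < - norm y - \<phi> y" by simp
    define t where "t = (c + 1) / (- norm y - \<phi> y)"
    have t: "0 < t" "t * (- norm y - \<phi> y) = c + 1" using pos c by (auto simp: t_def)
    have "- norm (t *\<^sub>R y) \<le> \<phi> (t *\<^sub>R y) + c" by (rule \<phi>)
    then show False using t by (simp add: blinfun.scaleR_right algebra_simps)
  qed
  have "\<bar>\<phi> y\<bar> \<le> norm y" for y using lower[of y] lower[of "- y"] by (simp add: blinfun.minus_right abs_le_iff)
  then have "norm \<phi> \<le> 1" by (intro norm_blinfun_bound) auto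
  moreover have "norm x \<le> \<phi> x" using \<phi>(1)[of "- x" "- norm x"] c by (simp add: blinfun.minus_right)
  ultimately show ?thesis using that \<open>\<And>y. \<bar>\<phi> y\<bar> \<le> norm y\<close>[of x] by (simp add: abs_le_iff order_antisym)
qed

text \<open>
  If \<open>d > 0\<close> is at most the distance from \<open>x\<close> to \<open>D\<close>, then \<open>D\<close> placed at height \<open>- d\<close> lies above the concave function
  \<open>y \<mapsto> - dist x y\<close>, whose value at \<open>x\<close> is \<open>0\<close>.
\<close>

corollary separate_point_closed_convex:
  fixes D :: "'a::real_normed_vector set"
  assumes D: "convex D" "closed D" and x: "x \<notin> D"
  obtains \<phi> :: "'a \<Rightarrow>\<^sub>L real" and s :: real where "\<And>y. y \<in> D \<Longrightarrow> \<phi> y \<le> s" "s < \<phi> x"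
proof (cases "D = {}")
  case True then show ?thesis using that[of 0 "-1"] by simp
next
  case False
  obtain d where d: "0 < d" "\<And>y. y \<in> D \<Longrightarrow> d \<le> dist x y"
  proof -
    obtain e where "0 < e" "ball x e \<subseteq> - D"
      using D(2) x open_contains_ball[of "- D"] by (auto simp: open_Compl)
    then show ?thesis using that[of e] by (force simp: subset_eq)
  qed
  obtain \<phi> :: "'a \<Rightarrow>\<^sub>L real" and c where \<phi>: "\<And>s r. (s, r) \<in> D \<times> {- d} \<Longrightarrow> \<phi> s + c \<le> r"
    "\<And>y. - dist x y \<le> \<phi> y + c"
  proof (rule sandwich[of "D \<times> {- d}" "dist x" 1 x 1])
    show "convex_on UNIV (dist x)" by (rule convex_on_dist) simp
  qed (use D d False in \<open>auto simp: convex_Times\<close>)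
  have "\<phi> y \<le> \<phi> x - d" if "y \<in> D" for y using \<phi>(1)[of y "- d"] \<phi>(2)[of x] that by auto
  then show ?thesis using that[of \<phi> "\<phi> x - d"] d by simp
qed

section \<open>Self-conjugate functions and their contact sets\<close>

text \<open>
  A Banach space identified with its dual by a symmetric form. The last two assumptions say that the
  map \<open>w \<mapsto> b w\<close> onto the dual is surjective and that norms are attained, as for \<open>X \<times> X*\<close> with \<open>X\<close>
  reflexive.
\<close>

locale self_paired_space =
  fixes b :: "'z::banach \<Rightarrow> 'z \<Rightarrow> real"
  assumes add_left: "b (z + z') w = b z w + b z' w"
    and scale_left: "b (t *\<^sub>R z) w = t * b z w"
    and sym: "b z w = b w z"
    and le_norm: "\<bar>b z w\<bar> \<le> norm z * norm w"
    and represents: "\<exists>w. \<forall>z. blinfun_apply \<phi> z = b w z"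
    and norming: "\<exists>w. norm w \<le> norm z \<and> b z w = (norm z)\<^sup>2"
begin

lemma add_right: "b w (z + z') = b w z + b w z'"
  using add_left sym by metis

lemma scale_right: "b w (t *\<^sub>R z) = t * b w z"
  using scale_left sym by metis

lemma minus_left: "b (- z) w = - b z w"
  using scale_left[of "- 1" z w] by simp

lemma minus_right: "b w (- z) = - b w z"
  using minus_left sym by metis

lemma diff_left: "b (z - z') w = b z w - b z' w"
  using add_left[of z "- z'" w] minus_left by simp

lemma diff_right: "b w (z - z') = b w z - b w z'"
  using diff_left sym by metis

lemmas bilinear_simps = add_left add_right scale_left scale_right minus_left minus_right diff_left diff_right

lemma continuous_left: "continuous_on UNIV (\<lambda>z. b z w)"
proof -
  have "bounded_linear (\<lambda>z. b z w)"
    by (rule bounded_linear_intro[of _ "norm w"])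
      (use le_norm[of _ w] in \<open>auto simp: add_left scale_left\<close>)
  then show ?thesis by (rule linear_continuous_on)
qed

definition quad :: "'z \<Rightarrow> real" where
  "quad z = b z z / 2"

text \<open>
  If \<open>E\<close> is the epigraph of \<open>f\<close>, this is the epigraph of the conjugate \<open>z \<mapsto> sup (b z w - f w)\<close>.
\<close>

definition polar_epi :: "('z \<times> real) set \<Rightarrow> ('z \<times> real) set" where
  "polar_epi E = {(z, r). \<forall>(w, s)\<in>E. b z w \<le> r + s}"

lemma polar_epiI: "(\<And>w s. (w, s) \<in> E \<Longrightarrow> b z w \<le> r + s) \<Longrightarrow> (z, r) \<in> polar_epi E"
  by (auto simp: polar_epi_def)

lemma polar_epiD: "(z, r) \<in> polar_epi E \<Longrightarrow> (w, s) \<in> E \<Longrightarrow> b z w \<le> r + s"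
  by (auto simp: polar_epi_def)

lemma convex_polar_epi: "convex (polar_epi E)"
  unfolding convex_alt
proof (intro ballI allI impI)
  fix a c :: "'z \<times> real" and t :: real
  assume a: "a \<in> polar_epi E" and c: "c \<in> polar_epi E" and t: "0 \<le> t \<and> t \<le> 1"
  obtain z r where [simp]: "a = (z, r)" by (cases a)
  obtain z' r' where [simp]: "c = (z', r')" by (cases c)
  have "((1 - t) *\<^sub>R z + t *\<^sub>R z', (1 - t) * r + t * r') \<in> polar_epi E"
  proof (rule polar_epiI)
    fix w s assume w: "(w, s) \<in> E"
    have "b z w \<le> r + s" "b z' w \<le> r' + s" using a c w polar_epiD by auto
    then have "(1 - t) * b z w + t * b z' w \<le> (1 - t) * (r + s) + t * (r' + s)"
      using t by (intro add_mono mult_left_mono) auto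
    then show "b ((1 - t) *\<^sub>R z + t *\<^sub>R z') w \<le> (1 - t) * r + t * r' + s"
      by (simp add: bilinear_simps algebra_simps)
  qed
  then show "(1 - t) *\<^sub>R a + t *\<^sub>R c \<in> polar_epi E" by simp
qed

definition contact :: "('z \<times> real) set \<Rightarrow> 'z set" where
  "contact K = {z. (z, quad z) \<in> K}"

lemma quad_diff: "quad (z - w) = quad z + quad w - b z w"
  by (simp add: quad_def bilinear_simps sym[of w z] field_simps)

lemma contact_monotone:
  assumes "K \<subseteq> polar_epi K" "z \<in> contact K" "w \<in> contact K"
  shows "0 \<le> quad (z - w)"
proof -
  have "b z w \<le> quad z + quad w" using assms polar_epiD by (fastforce simp: contact_def)
  then show ?thesis by (simp add: quad_diff)
qed

text \<open>
  Let \<open>k\<close> be the function with epigraph \<open>K\<close>, so \<open>k \<ge> quad\<close>, and let \<open>h\<close> translate its epigraph so that \<open>z0\<close> becomes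
  the origin while the difference to \<open>quad\<close> is preserved. The translated function is above \<open>quad\<close>, hence above \<open>-(norm y)\<^sup>2 / 2\<close>,
  and a functional \<open>b p\<close> with constant \<open>c\<close> fits in between. Norming gives \<open>c \<ge> (norm p)\<^sup>2 / 2\<close>,
  and self-conjugacy turns the lower bound for \<open>k\<close> into the upper bound
  \<open>k (z0 + p) \<le> quad (z0 + p) - quad p - c\<close>. As \<open>k \<ge> quad\<close> and \<open>quad p \<ge> - c\<close>, the point
  \<open>z0 + p\<close> is in the contact set, and now \<open>0 \<le> quad p \<le> - c \<le> - (norm p)\<^sup>2 / 2\<close>. The squared norm serves here
  instead of a general self-dual kernel because such a kernel may vanish away from \<open>0\<close>.
\<close>

theorem contact_maximal:
  assumes K: "K = polar_epi K" "K \<noteq> {}" and z0: "\<And>z. z \<in> contact K \<Longrightarrow> 0 \<le> quad (z - z0)"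
  shows "z0 \<in> contact K"
proof -
  have up: "(z, s) \<in> K" if "(z, r) \<in> K" "r \<le> s" for z r s
    using that K(1) polar_epiD by (smt (verit) polar_epiI)
  have above: "quad z \<le> r" if "(z, r) \<in> K" for z r
    using that K(1) polar_epiD[of z r K z r] by (auto simp: quad_def)
  define h where "h = (\<lambda>(z, r). (z - z0, r - b (z - z0) z0 - quad z0))"
  define S where "S = h ` K"
  have "convex S" unfolding convex_alt
  proof (intro ballI allI impI)
    fix x y and t :: real assume "x \<in> S" "y \<in> S" and t: "0 \<le> t \<and> t \<le> 1"
    then obtain x' y' where *: "x' \<in> K" "y' \<in> K" "x = h x'" "y = h y'" by (auto simp: S_def)
    have "(1 - t) *\<^sub>R x' + t *\<^sub>R y' \<in> K"
      using convex_polar_epi[of K] K(1) * t unfolding convex_alt by metis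
    moreover have "h ((1 - t) *\<^sub>R x' + t *\<^sub>R y') = (1 - t) *\<^sub>R x + t *\<^sub>R y"
      unfolding * by (cases x'; cases y') (simp add: h_def bilinear_simps quad_def field_simps)
    ultimately show "(1 - t) *\<^sub>R x + t *\<^sub>R y \<in> S" unfolding S_def by (metis imageI)
  qed
  have quad_le: "- (norm w)\<^sup>2 / 2 \<le> quad w" for w
    using le_norm[of w w] by (simp add: quad_def power2_eq_square abs_le_iff)
  obtain \<phi> :: "'z \<Rightarrow>\<^sub>L real" and c where \<phi>:
    "\<And>s r. (s, r) \<in> S \<Longrightarrow> \<phi> s + c \<le> r" "\<And>y. - ((norm y)\<^sup>2 / 2) \<le> \<phi> y + c"
  proof (rule sandwich[of S "\<lambda>y. (norm y)\<^sup>2 / 2" 1 0 1])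
    show "convex S" by fact
    show "S \<noteq> {}" using K(2) by (simp add: S_def)
    show "convex_on UNIV (\<lambda>y::'z. (norm y)\<^sup>2 / 2)"
      by (rule convex_on_cdiv[OF _ convex_on_norm_squared]) simp
    show "- ((norm s)\<^sup>2 / 2) \<le> r" if "(s, r) \<in> S" for s r
    proof -
      obtain z r' where *: "(z, r') \<in> K" "s = z - z0" "r = r' - b (z - z0) z0 - quad z0"
        using \<open>(s, r) \<in> S\<close> by (auto simp: S_def h_def)
      have "quad (z - z0) = quad z - b (z - z0) z0 - quad z0"
        by (simp add: quad_def bilinear_simps sym[of z0 z] field_simps)
      then show ?thesis using above[OF *(1)] quad_le[of "z - z0"] * by simp
    qed
    show "(norm y)\<^sup>2 / 2 \<le> 1" if "y \<in> ball 0 1" for y :: 'z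
      using that power_le_one[of "norm y" 2] by simp
  qed auto
  obtain p where p: "\<And>z. \<phi> z = b p z" using represents by blast
  obtain w where w: "norm w \<le> norm p" "b p w = (norm p)\<^sup>2" using norming by blast
  have "(norm w)\<^sup>2 \<le> (norm p)\<^sup>2" using w(1) by (intro power_mono) auto
  then have c: "(norm p)\<^sup>2 / 2 \<le> c" using \<phi>(2)[of "- w"] w(2) unfolding p minus_right norm_minus_cancel by linarith
  have "(z0 + p, quad (z0 + p) - quad p - c) \<in> polar_epi K"
  proof (rule polar_epiI)
    fix z r assume "(z, r) \<in> K"
    then have "(z - z0, r - b (z - z0) z0 - quad z0) \<in> S" by (force simp: S_def h_def)
    then have "b p (z - z0) + c \<le> r - b (z - z0) z0 - quad z0" using \<phi>(1) p by metis
    then show "b (z0 + p) z \<le> quad (z0 + p) - quad p - c + r"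
      by (simp add: quad_def bilinear_simps sym[of z z0] sym[of z0 p] field_simps)
  qed
  then have mem: "(z0 + p, quad (z0 + p) - quad p - c) \<in> K" using K(1) by simp
  moreover have "0 \<le> quad p + c" using quad_le[of p] c by simp
  ultimately have "z0 + p \<in> contact K" unfolding contact_def by (auto intro: up)
  then have "0 \<le> quad p" using z0 by fastforce
  moreover have "quad p + c \<le> 0" using above[OF mem] by simp
  ultimately have "(norm p)\<^sup>2 \<le> 0" using c by linarith
  then have "p = 0" by simp
  then show ?thesis using \<open>z0 + p \<in> contact K\<close> by simp
qed

end

section \<open>Averaging through a self-dual kernel\<close>

text \<open>
  The last two assumptions state that \<open>\<psi>\<close> is its own conjugate, without suprema.
\<close>

locale self_paired_kernel = self_paired_space b for b :: "'z::banach \<Rightarrow> 'z \<Rightarrow> real" +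
  fixes \<psi> :: "'z \<Rightarrow> real"
  assumes even: "\<psi> (- z) = \<psi> z"
    and young: "b z w \<le> \<psi> z + \<psi> w"
    and dual: "(\<And>w. b z w \<le> \<psi> w + k) \<Longrightarrow> \<psi> z \<le> k"
begin

lemma kernel_zero: "\<psi> 0 = 0"
proof -
  have nonneg: "0 \<le> \<psi> w" for w
    using young[of w w] young[of w "- w"] even[of w] by (simp add: bilinear_simps)
  have "\<psi> 0 \<le> 0" by (rule dual) (use nonneg scale_left[of 0 0] in auto)
  then show ?thesis using nonneg[of 0] by simp
qed

lemma kernel_convex: "convex_on UNIV \<psi>"
proof (rule convex_onI)
  fix t :: real and z z' assume t: "0 < t" "t < 1"
  show "\<psi> ((1 - t) *\<^sub>R z + t *\<^sub>R z') \<le> (1 - t) * \<psi> z + t * \<psi> z'"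
  proof (rule dual)
    fix w
    have "(1 - t) * b z w + t * b z' w \<le> (1 - t) * (\<psi> z + \<psi> w) + t * (\<psi> z' + \<psi> w)"
      using t young by (intro add_mono mult_left_mono) auto
    then show "b ((1 - t) *\<^sub>R z + t *\<^sub>R z') w \<le> \<psi> w + ((1 - t) * \<psi> z + t * \<psi> z')"
      by (simp add: bilinear_simps algebra_simps)
  qed
qed auto

text \<open>
  The sublevel sets of \<open>\<psi>\<close> are closed, because \<open>\<psi>\<close> is a supremum of continuous affine functions, and
  they cover the space. By Baire's theorem one of them has interior points.
\<close>

lemma kernel_bounded_on_ball:
  obtains y0 \<delta> M where "0 < \<delta>" "\<And>y. y \<in> ball y0 \<delta> \<Longrightarrow> \<psi> y \<le> M"
proof -
  define L where "L n = {z. \<psi> z \<le> real n}" for n :: nat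
  have "L n = (\<Inter>w. {z. b z w \<le> \<psi> w + real n})" for n
  proof (intro equalityI subsetI)
    fix z assume "z \<in> L n"
    then have "b z w \<le> \<psi> w + real n" for w using young[of z w] by (simp add: L_def)
    then show "z \<in> (\<Inter>w. {z. b z w \<le> \<psi> w + real n})" by blast
  next
    fix z assume "z \<in> (\<Inter>w. {z. b z w \<le> \<psi> w + real n})"
    then show "z \<in> L n" by (auto simp: L_def intro: dual)
  qed
  then have closed: "closed (L n)" for n
    using continuous_left by (auto intro!: closed_Collect_le continuous_intros)
  have union: "\<Union> (range L) = UNIV" using real_arch_simple by (auto simp: L_def)
  have "\<exists>n. interior (L n) \<noteq> {}"
  proof (rule ccontr)
    assume "\<not> ?thesis"
    then have "euclidean interior_of \<Union> (range L) = {}"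
      using closed completely_metrizable_space_euclidean by (intro Baire_category_alt) auto
    then show False by (simp add: union)
  qed
  then obtain n y0 where "y0 \<in> interior (L n)" by blast
  then obtain \<delta> where "0 < \<delta>" "ball y0 \<delta> \<subseteq> L n" by (auto simp: mem_interior)
  then show ?thesis using that[of \<delta> y0 "real n"] by (simp add: L_def subset_eq)
qed

text \<open>
  If \<open>E\<close> is the epigraph of \<open>f\<close>, this is the union of the half-lines above the values that compete in
  the kernel average. It is the epigraph of the kernel average once the infimum is attained.
\<close>

definition average_epi :: "('z \<times> real) set \<Rightarrow> ('z \<times> real) set" where
  "average_epi E = {((1/2) *\<^sub>R (z1 + z2), r) | z1 z2 r. \<exists>r1 r2. (z1, r1) \<in> E \<and> (z2, r2) \<in> polar_epi E \<and>
      r1 / 2 + r2 / 2 + \<psi> (z1 - z2) / 4 \<le> r}"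

lemma average_epiI:
  "(z1, r1) \<in> E \<Longrightarrow> (z2, r2) \<in> polar_epi E \<Longrightarrow> r1 / 2 + r2 / 2 + \<psi> (z1 - z2) / 4 \<le> r \<Longrightarrow>
    ((1/2) *\<^sub>R (z1 + z2), r) \<in> average_epi E"
  unfolding average_epi_def by blast

lemma average_epiE:
  assumes "(z, r) \<in> average_epi E"
  obtains z1 r1 z2 r2 where "(z1, r1) \<in> E" "(z2, r2) \<in> polar_epi E" "z = (1/2) *\<^sub>R (z1 + z2)"
    "r1 / 2 + r2 / 2 + \<psi> (z1 - z2) / 4 \<le> r"
  using assms unfolding average_epi_def by blast

text \<open>
  With \<open>z = (z1 + z2) / 2\<close> and \<open>w = (w1 + w2) / 2\<close>, expansion gives
  \<open>b z w = (b z2 w1 + b w2 z1) / 2 + b (z1 - z2) (w1 - w2) / 4\<close>, and Young's inequality applies to each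
  summand.
\<close>

lemma average_epi_subset_polar: "average_epi E \<subseteq> polar_epi (average_epi E)"
proof (clarify, rule polar_epiI)
  fix z r w s assume "(z, r) \<in> average_epi E" "(w, s) \<in> average_epi E"
  obtain z1 r1 z2 r2 where z: "(z1, r1) \<in> E" "(z2, r2) \<in> polar_epi E" "z = (1/2) *\<^sub>R (z1 + z2)"
    "r1 / 2 + r2 / 2 + \<psi> (z1 - z2) / 4 \<le> r"
    using \<open>(z, r) \<in> average_epi E\<close> by (rule average_epiE)
  obtain w1 s1 w2 s2 where w: "(w1, s1) \<in> E" "(w2, s2) \<in> polar_epi E" "w = (1/2) *\<^sub>R (w1 + w2)"
    "s1 / 2 + s2 / 2 + \<psi> (w1 - w2) / 4 \<le> s"
    using \<open>(w, s) \<in> average_epi E\<close> by (rule average_epiE)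
  have "b z w = (b z2 w1 + b w2 z1) / 2 + b (z1 - z2) (w1 - w2) / 4"
    by (simp add: z w bilinear_simps sym[of w2 z1] field_simps)
  moreover have "b z2 w1 \<le> r2 + s1" "b w2 z1 \<le> s2 + r1" using polar_epiD z w by blast+
  ultimately show "b z w \<le> r + s" using young[of "z1 - z2" "w1 - w2"] z(4) w(4) by (simp add: field_simps)
qed

text \<open>
  Membership of \<open>(z, r)\<close> in the polar says that
  \<open>f z1 + f* z2 - b z (z1 + z2) \<ge> - \<psi> (z1 - z2) / 2 - 2 r\<close> for all \<open>z1\<close> and \<open>z2\<close>. The set \<open>S\<close>
  collects the left-hand sides over the points \<open>z1 - z2\<close>, and the sandwich theorem supplies an affine function
  \<open>b p + c\<close> in between. The upper half separates into \<open>f* (z + p) + f** (z - p) \<le> - c\<close>, and the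
  lower half becomes \<open>\<psi> (2 p) \<le> 2 c + 4 r\<close> by self-duality of \<open>\<psi>\<close>. Hence the pair
  \<open>z - p\<close>, \<open>z + p\<close> witnesses that \<open>(z, r)\<close> lies in the average.
\<close>

lemma polar_subset_average_epi:
  assumes E: "convex E" "E \<noteq> {}" "polar_epi E \<noteq> {}" "polar_epi (polar_epi E) \<subseteq> E"
  shows "polar_epi (average_epi E) \<subseteq> average_epi E"
proof clarify
  fix z r assume zr: "(z, r) \<in> polar_epi (average_epi E)"
  define h where "h = (\<lambda>((z1, r1), (z2, r2)). (z1 - z2, r1 + r2 - b z (z1 + z2)))"
  define S where "S = h ` (E \<times> polar_epi E)"
  have S_memI: "(z1 - z2, r1 + r2 - b z (z1 + z2)) \<in> S"
    if "(z1, r1) \<in> E" "(z2, r2) \<in> polar_epi E" for z1 r1 z2 r2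
    using that unfolding S_def h_def by force
  have S_memE: "\<exists>z1 r1 z2 r2. (z1, r1) \<in> E \<and> (z2, r2) \<in> polar_epi E \<and> y = z1 - z2 \<and>
      s = r1 + r2 - b z (z1 + z2)" if "(y, s) \<in> S" for y s
    using that unfolding S_def h_def by force
  have "linear h"
    by (rule linearI) (auto simp: h_def bilinear_simps algebra_simps)
  then have "convex S" unfolding S_def
    using E(1) convex_polar_epi by (intro convex_linear_image convex_Times) auto
  obtain y0 \<delta> M where bounded: "0 < \<delta>" "\<And>y. y \<in> ball y0 \<delta> \<Longrightarrow> \<psi> y \<le> M"
    by (rule kernel_bounded_on_ball) blast
  obtain \<phi> :: "'z \<Rightarrow>\<^sub>L real" and c where \<phi>:
    "\<And>y s. (y, s) \<in> S \<Longrightarrow> \<phi> y + c \<le> s" "\<And>y. - (\<psi> y / 2 + 2 * r) \<le> \<phi> y + c"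
  proof (rule sandwich[of S "\<lambda>y. \<psi> y / 2 + 2 * r" \<delta> y0 "M / 2 + 2 * r"])
    show "convex S" by fact
    show "S \<noteq> {}" using E by (auto simp: S_def)
    show "convex_on UNIV (\<lambda>y. \<psi> y / 2 + 2 * r)"
      using convex_on_cdiv[OF _ kernel_convex, of 2] by (intro convex_on_add) (auto simp: convex_on_const)
    show "- (\<psi> y / 2 + 2 * r) \<le> s" if "(y, s) \<in> S" for y s
    proof -
      obtain z1 r1 z2 r2 where *: "(z1, r1) \<in> E" "(z2, r2) \<in> polar_epi E" "y = z1 - z2"
        "s = r1 + r2 - b z (z1 + z2)" using S_memE[OF \<open>(y, s) \<in> S\<close>] by blast
      have "((1/2) *\<^sub>R (z1 + z2), r1 / 2 + r2 / 2 + \<psi> (z1 - z2) / 4) \<in> average_epi E"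
        using * by (intro average_epiI) auto
      from polar_epiD[OF zr this] show ?thesis by (simp add: * bilinear_simps)
    qed
  qed (use bounded in auto)
  obtain p where p: "\<And>y. \<phi> y = b p y" using represents by blast
  have "\<psi> (2 *\<^sub>R p) \<le> 2 * c + 4 * r"
  proof (rule dual)
    fix w
    show "b (2 *\<^sub>R p) w \<le> \<psi> w + (2 * c + 4 * r)"
      using \<phi>(2)[of "- w"] even[of w] by (simp add: p bilinear_simps)
  qed
  have split: "(b (z + p) z1 - r1) + (b (z - p) z2 - r2) \<le> - c"
    if "(z1, r1) \<in> E" "(z2, r2) \<in> polar_epi E" for z1 r1 z2 r2
    using \<phi>(1)[OF S_memI[OF that]] by (simp add: p bilinear_simps)
  define s1 where "s1 = Sup ((\<lambda>(z2, r2). b (z - p) z2 - r2) ` polar_epi E)"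
  obtain e a where "(e, a) \<in> E" using E by auto
  then have bdd: "bdd_above ((\<lambda>(z2, r2). b (z - p) z2 - r2) ` polar_epi E)"
    using split[of e a] by (intro bdd_aboveI2[of _ _ "- c - (b (z + p) e - a)"]) fastforce
  have up: "b (z - p) z2 - r2 \<le> s1" if "(z2, r2) \<in> polar_epi E" for z2 r2
    unfolding s1_def using cSUP_upper[OF that bdd] by simp
  have least: "s1 \<le> - c - (b (z + p) z1 - r1)" if "(z1, r1) \<in> E" for z1 r1
    unfolding s1_def by (rule cSUP_least[OF E(3)]) (use split[OF that] in fastforce)
  have mem1: "(z - p, s1) \<in> polar_epi (polar_epi E)"
    by (rule polar_epiI) (use up in fastforce)
  have mem2: "(z + p, - c - s1) \<in> polar_epi E"
    by (rule polar_epiI) (use least in fastforce)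
  have "((1/2) *\<^sub>R ((z - p) + (z + p)), r) \<in> average_epi E"
  proof (rule average_epiI[OF _ mem2])
    show "(z - p, s1) \<in> E" using mem1 E(4) by blast
    have "(z - p) - (z + p) = - (2 *\<^sub>R p)" by (simp add: scaleR_2)
    then show "s1 / 2 + (- c - s1) / 2 + \<psi> ((z - p) - (z + p)) / 4 \<le> r"
      using \<open>\<psi> (2 *\<^sub>R p) \<le> 2 * c + 4 * r\<close> even[of "2 *\<^sub>R p"] by (simp add: field_simps)
  qed
  moreover have "(1/2) *\<^sub>R ((z - p) + (z + p)) = z" by (simp add: scaleR_2[symmetric])
  ultimately show "(z, r) \<in> average_epi E" by simp
qed

text \<open>
  The hypothesis \<open>onto\<close> lets \<open>T\<close> preserve the polar as well: testing \<open>T z\<close> against \<open>w = T w'\<close> amounts to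
  testing \<open>z\<close> against \<open>w'\<close>.
\<close>

lemma average_epi_invariant:
  assumes T: "linear T" "\<And>z w. b (T z) (T w) = b z w" "\<And>z. \<psi> (T z) = \<psi> z"
    and into: "\<And>z r. (z, r) \<in> E \<Longrightarrow> (T z, r) \<in> E"
    and onto: "\<And>w s. (w, s) \<in> E \<Longrightarrow> \<exists>w'. w = T w' \<and> (w', s) \<in> E"
    and z: "(z, r) \<in> average_epi E"
  shows "(T z, r) \<in> average_epi E"
proof -
  obtain z1 r1 z2 r2 where *: "(z1, r1) \<in> E" "(z2, r2) \<in> polar_epi E" "z = (1/2) *\<^sub>R (z1 + z2)"
    "r1 / 2 + r2 / 2 + \<psi> (z1 - z2) / 4 \<le> r"
    using z by (rule average_epiE)
  have "(T z2, r2) \<in> polar_epi E"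
  proof (rule polar_epiI)
    fix w s assume "(w, s) \<in> E"
    then obtain w' where "w = T w'" "(w', s) \<in> E" using onto by blast
    then show "b (T z2) w \<le> r2 + s" using T(2) polar_epiD[OF *(2)] by simp
  qed
  moreover have "\<psi> (T z1 - T z2) = \<psi> (z1 - z2)" using T(3) linear_diff[OF T(1)] by metis
  ultimately have "((1/2) *\<^sub>R (T z1 + T z2), r) \<in> average_epi E"
    using into *(1,4) by (intro average_epiI) auto
  then show ?thesis using *(3) T(1) by (simp add: linear_add linear_scale)
qed

theorem average_epi_self_polar:
  assumes "convex E" "E \<noteq> {}" "polar_epi E \<noteq> {}" "polar_epi (polar_epi E) \<subseteq> E"
  shows "average_epi E = polar_epi (average_epi E)" "average_epi E \<noteq> {}"
proof -
  show "average_epi E = polar_epi (average_epi E)"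
    using average_epi_subset_polar polar_subset_average_epi[OF assms] by blast
  obtain z1 r1 z2 r2 where "(z1, r1) \<in> E" "(z2, r2) \<in> polar_epi E" using assms by fastforce
  from average_epiI[OF this order.refl] show "average_epi E \<noteq> {}" by blast
qed

end

section \<open>The product of a reflexive space and its dual\<close>

definition pair_form :: "'a::real_normed_vector \<times> 'a dual \<Rightarrow> 'a \<times> 'a dual \<Rightarrow> real" where
  "pair_form z w = pairing (snd z) (fst w) + pairing (snd w) (fst z)"

lemma pair_form_le_norm: "\<bar>pair_form z w\<bar> \<le> norm z * norm w"
proof -
  have "\<bar>pair_form z w\<bar> \<le> \<bar>pairing (snd z) (fst w)\<bar> + \<bar>pairing (snd w) (fst z)\<bar>"
    by (simp add: pair_form_def)
  also have "\<dots> \<le> norm (snd z) * norm (fst w) + norm (snd w) * norm (fst z)"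
    using norm_blinfun[of "snd z" "fst w"] norm_blinfun[of "snd w" "fst z"] by simp
  also have "\<dots> = (norm (fst z), norm (snd z)) \<bullet> (norm (snd w), norm (fst w))"
    by (simp add: inner_prod_def mult.commute)
  also have "\<dots> \<le> norm (norm (fst z), norm (snd z)) * norm (norm (snd w), norm (fst w))"
    by (rule norm_cauchy_schwarz)
  also have "\<dots> = norm z * norm w"
    by (simp add: norm_prod_def add.commute)
  finally show ?thesis .
qed

lemma pair_form_represents:
  fixes \<phi> :: "('a::real_normed_vector \<times> 'a dual) \<Rightarrow>\<^sub>L real"
  assumes "reflexive_space TYPE('a)"
  shows "\<exists>w. \<forall>z. \<phi> z = pair_form w z"
proof -
  have bl: "bounded_linear (\<lambda>x. \<phi> (x, 0))" "bounded_linear (\<lambda>v. \<phi> (0, v))"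
    by (intro bounded_linear_compose[OF blinfun.bounded_linear_right] bounded_linear_Pair
        bounded_linear_zero bounded_linear_ident)+
  obtain y where y: "\<And>v. blinfun_apply (Blinfun (\<lambda>v. \<phi> (0, v))) v = pairing v y"
    using assms unfolding reflexive_space_def by blast
  have "\<phi> z = pair_form (y, Blinfun (\<lambda>x. \<phi> (x, 0))) z" for z
  proof -
    have "\<phi> z = \<phi> (fst z, 0) + \<phi> (0, snd z)" by (simp add: blinfun.add_right[symmetric])
    then show ?thesis using y[of "snd z"] by (simp add: pair_form_def bounded_linear_Blinfun_apply bl)
  qed
  then show ?thesis by blast
qed

text \<open>
  Norming functionals of \<open>x\<close> in \<open>X*\<close> and of \<open>v\<close> in \<open>X**\<close> are scaled to the norms of \<open>x\<close> and \<open>v\<close>. By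
  reflexivity the second one is evaluation at some \<open>y\<close>; a norming functional of \<open>y\<close>
  shows that \<open>y\<close> has norm at most \<open>1\<close>.
\<close>

lemma pair_form_norming:
  fixes z :: "'a::real_normed_vector \<times> 'a dual"
  assumes "reflexive_space TYPE('a)"
  shows "\<exists>w. norm w \<le> norm z \<and> pair_form z w = (norm z)\<^sup>2"
proof -
  obtain x v where z: "z = (x, v)" by (cases z)
  obtain m :: "'a dual" where m: "norm m \<le> 1" "m x = norm x" by (rule norming_functional)
  obtain \<Phi> :: "'a dual dual" where \<Phi>: "norm \<Phi> \<le> 1" "\<Phi> v = norm v" by (rule norming_functional)
  obtain y where y: "\<And>v. \<Phi> v = pairing v y"
    using assms unfolding reflexive_space_def by blast
  obtain k :: "'a dual" where k: "norm k \<le> 1" "k y = norm y" by (rule norming_functional)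
  have "norm y = \<Phi> k" using k y by simp
  also have "\<dots> \<le> norm \<Phi> * norm k" using norm_blinfun[of \<Phi> k] by simp
  also have "\<dots> \<le> 1" using \<Phi>(1) k(1) by (simp add: mult_le_one)
  finally have ny: "norm y \<le> 1" .
  define w where "w = (norm v *\<^sub>R y, norm x *\<^sub>R m)"
  have "norm (fst w) \<le> norm v" "norm (snd w) \<le> norm x"
    using ny m(1) by (auto simp: w_def mult_left_le)
  then have "(norm (fst w))\<^sup>2 + (norm (snd w))\<^sup>2 \<le> (norm v)\<^sup>2 + (norm x)\<^sup>2"
    by (intro add_mono power_mono) auto
  then have "norm w \<le> norm z" by (simp add: norm_prod_def z add.commute)
  moreover have "pair_form z w = (norm z)\<^sup>2"
    using m \<Phi> y by (simp add: pair_form_def z w_def norm_prod_def blinfun.scaleR_right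
        blinfun.scaleR_left power2_eq_square)
  ultimately show ?thesis by blast
qed

lemma conjugate_eq_SUP:
  "conjugate f (v, x) = (SUP w. ereal (pair_form (x, v) w) - f w)"
  unfolding conjugate_def by (simp add: pair_form_def case_prod_beta add.commute)

section \<open>Kernel averages of extended-valued functions\<close>

definition epi :: "('b \<Rightarrow> ereal) \<Rightarrow> ('b \<times> real) set" where
  "epi f = {(z, r). f z \<le> ereal r}"

locale reflexive_kernel =
  fixes \<psi> :: "'a::banach \<times> 'a dual \<Rightarrow> real"
  assumes reflexive: "reflexive_space TYPE('a)"
    and self_dual: "self_dual_kernel \<psi>"

sublocale reflexive_kernel \<subseteq> self_paired_kernel pair_form \<psi>
proof
  have \<psi>: "ereal (\<psi> z) = (SUP w. ereal (pair_form z w) - ereal (\<psi> w))" for z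
    using self_dual unfolding self_dual_kernel_def conjugate_eq_SUP by (cases z) simp
  fix z w z' :: "'a \<times> 'a dual" and t k :: real and \<phi> :: "('a \<times> 'a dual) \<Rightarrow>\<^sub>L real"
  show "pair_form (z + z') w = pair_form z w + pair_form z' w"
    by (simp add: pair_form_def blinfun.bilinear_simps)
  show "pair_form (t *\<^sub>R z) w = t * pair_form z w"
    by (simp add: pair_form_def blinfun.bilinear_simps algebra_simps)
  show "pair_form z w = pair_form w z" by (simp add: pair_form_def)
  show "\<bar>pair_form z w\<bar> \<le> norm z * norm w" by (rule pair_form_le_norm)
  show "\<exists>w. \<forall>z. \<phi> z = pair_form w z" by (rule pair_form_represents[OF reflexive])
  show "\<exists>w. norm w \<le> norm z \<and> pair_form z w = (norm z)\<^sup>2" by (rule pair_form_norming[OF reflexive])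
  show "\<psi> (- z) = \<psi> z" using self_dual unfolding self_dual_kernel_def by blast
  have "ereal (pair_form z w) - ereal (\<psi> w) \<le> ereal (\<psi> z)"
    unfolding \<psi>[of z] by (rule SUP_upper) simp
  then show "pair_form z w \<le> \<psi> z + \<psi> w" by simp
  show "\<psi> z \<le> k" if "\<And>w. pair_form z w \<le> \<psi> w + k"
  proof -
    have "ereal (\<psi> z) \<le> ereal k"
      unfolding \<psi>[of z] by (rule SUP_least) (use that in \<open>simp add: algebra_simps\<close>)
    then show ?thesis by simp
  qed
qed

context reflexive_kernel
begin

lemma quad_eq_pairing: "quad (x, v) = pairing v x"
  by (simp add: quad_def pair_form_def)

lemma conjugate_le_iff:
  assumes "\<And>z. f z \<noteq> -\<infinity>"
  shows "conjugate f (v, x) \<le> ereal r \<longleftrightarrow> ((x, v), r) \<in> polar_epi (epi f)"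
proof
  assume le: "conjugate f (v, x) \<le> ereal r"
  show "((x, v), r) \<in> polar_epi (epi f)"
  proof (rule polar_epiI)
    fix w s assume "(w, s) \<in> epi f"
    then have "f w \<le> ereal s" by (simp add: epi_def)
    then have "ereal (pair_form (x, v) w) - ereal s \<le> ereal (pair_form (x, v) w) - f w"
      by (intro ereal_minus_mono) auto
    also have "\<dots> \<le> conjugate f (v, x)" unfolding conjugate_eq_SUP by (rule SUP_upper) simp
    also have "\<dots> \<le> ereal r" by (rule le)
    finally show "pair_form (x, v) w \<le> r + s" by simp
  qed
next
  assume mem: "((x, v), r) \<in> polar_epi (epi f)"
  show "conjugate f (v, x) \<le> ereal r" unfolding conjugate_eq_SUP
  proof (rule SUP_least)
    fix w
    show "ereal (pair_form (x, v) w) - f w \<le> ereal r"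
    proof (cases "f w")
      case (real s)
      then show ?thesis using polar_epiD[OF mem, of w s] by (simp add: epi_def)
    qed (use assms[of w] in auto)
  qed
qed

lemma conjugate_neq_MInf:
  assumes "(w, s) \<in> epi f"
  shows "conjugate f z \<noteq> -\<infinity>"
proof -
  obtain v x where z: "z = (v, x)" by (cases z)
  have "ereal (pair_form (x, v) w) - ereal s \<le> ereal (pair_form (x, v) w) - f w"
    using assms by (intro ereal_minus_mono) (auto simp: epi_def)
  also have "\<dots> \<le> conjugate f (v, x)" unfolding conjugate_eq_SUP by (rule SUP_upper) simp
  finally show ?thesis by (auto simp: z)
qed

lemma kernel_average_values_le:
  assumes f: "\<And>z. f z \<noteq> -\<infinity>" and ne: "epi f \<noteq> {}"
  shows "(\<exists>a\<in>kernel_average_values \<psi> f z. a \<le> ereal r) \<longleftrightarrow> (z, r) \<in> average_epi (epi f)"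
proof
  assume "\<exists>a\<in>kernel_average_values \<psi> f z. a \<le> ereal r"
  then obtain x1 v1 x2 v2 where z: "z = (1/2) *\<^sub>R (x1 + x2, v1 + v2)"
    and le: "ereal (1/2) * f (x1, v1) + ereal (1/2) * conjugate f (v2, x2)
      + ereal (1/4 * \<psi> (x1 - x2, v1 - v2)) \<le> ereal r"
    unfolding kernel_average_values_def by blast
  have "conjugate f (v2, x2) \<noteq> -\<infinity>" using ne conjugate_neq_MInf by fastforce
  then obtain r1 r2 where r: "f (x1, v1) = ereal r1" "conjugate f (v2, x2) = ereal r2"
    using le f[of "(x1, v1)"] by (cases "f (x1, v1)"; cases "conjugate f (v2, x2)") auto
  have "((x1, v1), r1) \<in> epi f" "((x2, v2), r2) \<in> polar_epi (epi f)"
    using r f conjugate_le_iff[of f v2 x2 r2] by (auto simp: epi_def)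
  then have "((1/2) *\<^sub>R ((x1, v1) + (x2, v2)), r) \<in> average_epi (epi f)"
    using le by (intro average_epiI) (auto simp: r)
  then show "(z, r) \<in> average_epi (epi f)" by (simp add: z)
next
  assume "(z, r) \<in> average_epi (epi f)"
  then obtain z1 r1 z2 r2 where *: "(z1, r1) \<in> epi f" "(z2, r2) \<in> polar_epi (epi f)"
    "z = (1/2) *\<^sub>R (z1 + z2)" "r1 / 2 + r2 / 2 + \<psi> (z1 - z2) / 4 \<le> r"
    by (rule average_epiE)
  obtain x1 v1 x2 v2 where z: "z1 = (x1, v1)" "z2 = (x2, v2)" by (cases z1; cases z2)
  let ?a = "ereal (1/2) * f (x1, v1) + ereal (1/2) * conjugate f (v2, x2)
      + ereal (1/4 * \<psi> (x1 - x2, v1 - v2))"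
  have "f (x1, v1) \<le> ereal r1" "conjugate f (v2, x2) \<le> ereal r2"
    using * f conjugate_le_iff[of f v2 x2 r2] by (auto simp: z epi_def)
  then have "?a \<le> ereal (1/2) * ereal r1 + ereal (1/2) * ereal r2 + ereal (1/4 * \<psi> (x1 - x2, v1 - v2))"
    by (intro add_mono ereal_mult_left_mono order.refl) auto
  also have "\<dots> \<le> ereal r" using * by (simp add: z)
  finally have "?a \<le> ereal r" .
  moreover have "?a \<in> kernel_average_values \<psi> f z"
    using *(3) unfolding kernel_average_values_def z by auto
  ultimately show "\<exists>a\<in>kernel_average_values \<psi> f z. a \<le> ereal r" by blast
qed

text \<open>
  The infimum is bounded below by \<open>b z w - s\<close> for every \<open>(w, s)\<close> in the average epigraph \<open>K\<close>. If it is a real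
  number \<open>m\<close>, these bounds say that \<open>(z, m)\<close> is in the polar of \<open>K\<close>, which is \<open>K\<close> itself, so some competing value
  is at most \<open>m\<close>. If it is \<open>\<infinity>\<close>, every competing value equals it.
\<close>

lemma kernel_average_attained:
  assumes f: "\<And>z. f z \<noteq> -\<infinity>" and ne: "epi f \<noteq> {}"
    and K: "average_epi (epi f) = polar_epi (average_epi (epi f))"
      "average_epi (epi f) \<noteq> {}"
  shows "kernel_average \<psi> f z \<in> kernel_average_values \<psi> f z"
proof -
  let ?K = "average_epi (epi f)" and ?V = "kernel_average_values \<psi> f z"
  note le_iff = kernel_average_values_le[OF f ne]
  obtain w s where ws: "(w, s) \<in> ?K" using K(2) by auto
  have lower: "ereal (pair_form z w - s) \<le> kernel_average \<psi> f z" if "(w, s) \<in> ?K" for w s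
    unfolding kernel_average_def
  proof (rule Inf_greatest, rule ereal_le_real)
    fix a r assume "a \<in> ?V" "a \<le> ereal r"
    then have "(z, r) \<in> polar_epi ?K" using le_iff K(1) by blast
    from polar_epiD[OF this that] show "ereal (pair_form z w - s) \<le> ereal r" by simp
  qed
  show ?thesis
  proof (cases "kernel_average \<psi> f z")
    case PInf
    obtain x v where z: "z = (x, v)" by (cases z)
    have "z = (1/2) *\<^sub>R (x + x, v + v)" by (simp add: z scaleR_2[symmetric])
    then have "?V \<noteq> {}" unfolding kernel_average_values_def by blast
    then show ?thesis using PInf by (auto simp: kernel_average_def Inf_eq_PInfty)
  next
    case MInf
    then show ?thesis using lower[OF ws] by simp
  next
    case (real m)
    have "(z, m) \<in> polar_epi ?K"
      by (rule polar_epiI) (use lower real in \<open>fastforce simp: algebra_simps\<close>)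
    then obtain a where a: "a \<in> ?V" "a \<le> ereal m" using le_iff K(1) by blast
    moreover have "ereal m \<le> a" using a(1) unfolding real[symmetric] kernel_average_def by (rule Inf_lower)
    ultimately show ?thesis using real by (metis order.antisym)
  qed
qed

lemma kernel_average_le_iff:
  assumes f: "\<And>z. f z \<noteq> -\<infinity>" and ne: "epi f \<noteq> {}"
    and K: "average_epi (epi f) = polar_epi (average_epi (epi f))"
      "average_epi (epi f) \<noteq> {}"
  shows "kernel_average \<psi> f z \<le> ereal r \<longleftrightarrow> (z, r) \<in> average_epi (epi f)"
  using kernel_average_attained[OF assms, of z] kernel_average_values_le[OF f ne, of z r]
  unfolding kernel_average_def by (meson Inf_lower order_trans)

lemma contact_set_kernel_average:
  assumes f: "\<And>z. f z \<noteq> -\<infinity>" and ne: "epi f \<noteq> {}"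
    and K: "average_epi (epi f) = polar_epi (average_epi (epi f))"
      "average_epi (epi f) \<noteq> {}"
  shows "contact_set (kernel_average \<psi> f) = contact (average_epi (epi f))"
proof -
  note le_iff = kernel_average_le_iff[OF assms]
  have above: "ereal (quad z) \<le> kernel_average \<psi> f z" for z
  proof (rule ereal_le_real)
    fix r assume "kernel_average \<psi> f z \<le> ereal r"
    then have "(z, r) \<in> average_epi (epi f)" by (simp add: le_iff)
    then have "pair_form z z \<le> r + r" using K(1) polar_epiD by blast
    then show "ereal (quad z) \<le> ereal r" by (simp add: quad_def)
  qed
  have "kernel_average \<psi> f z = ereal (quad z) \<longleftrightarrow> (z, quad z) \<in> average_epi (epi f)" for z
    using above[of z] le_iff[of z "quad z"] by (auto intro: order.antisym)
  then show ?thesis by (auto simp: contact_set_def contact_def quad_eq_pairing)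
qed

end

section \<open>The restricted Fitzpatrick function and its contact set\<close>

locale reflexive_kernel_operator = reflexive_kernel \<psi> for \<psi> :: "'a::banach \<times> 'a dual \<Rightarrow> real" +
  fixes A :: "('a \<times> 'a dual) set"
  assumes nonempty: "A \<noteq> {}" and monotone: "monotone_op A"
begin

abbreviation D :: "'a set" where "D \<equiv> closed_convex_hull (op_domain A)"

abbreviation F :: "'a \<times> 'a dual \<Rightarrow> ereal" where "F \<equiv> restricted_fitzpatrick A"

lemma D_convex: "convex D" and D_closed: "closed D"
  by (auto simp: closed_convex_hull_def intro: convex_closure convex_convex_hull)

lemma fst_mem_D: "a \<in> A \<Longrightarrow> fst a \<in> D"
  unfolding closed_convex_hull_def op_domain_def
  by (meson closure_subset hull_inc imageI in_mono)

lemma monotone_quad: "monotone_op B \<longleftrightarrow> (\<forall>z\<in>B. \<forall>w\<in>B. 0 \<le> quad (z - w))"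
  unfolding monotone_op_def by (simp add: case_prod_beta quad_eq_pairing[symmetric] minus_prod_def)

lemma fitzpatrick_eq_SUP: "fitzpatrick A z = (SUP a\<in>A. ereal (pair_form z a - quad a))"
proof -
  obtain x v where z: "z = (x, v)" by (cases z)
  define t where "t = (\<lambda>(v0, x0). ereal (pairing v0 x) + ereal (pairing v x0) - c_fun A (v0, x0))"
  have t: "t (snd a, fst a) = (if a \<in> A then ereal (pair_form z a - quad a) else -\<infinity>)" for a
    by (cases a) (simp add: t_def c_fun_def z pair_form_def quad_eq_pairing)
  have F: "fitzpatrick A z = (SUP w. t w)"
    by (simp add: fitzpatrick_def dual_conjugate_def z t_def)
  show ?thesis unfolding F
  proof (rule antisym)
    show "(SUP w. t w) \<le> (SUP a\<in>A. ereal (pair_form z a - quad a))"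
    proof (rule SUP_least)
      fix w :: "'a dual \<times> 'a"
      show "t w \<le> (SUP a\<in>A. ereal (pair_form z a - quad a))"
        using t[of "(snd w, fst w)"] by (cases "(snd w, fst w) \<in> A") (auto intro: SUP_upper)
    qed
    show "(SUP a\<in>A. ereal (pair_form z a - quad a)) \<le> (SUP w. t w)"
      using t by (intro SUP_mono) (metis UNIV_I order.refl)
  qed
qed

lemma fitzpatrick_neq_MInf: "fitzpatrick A z \<noteq> -\<infinity>"
proof -
  obtain a where "a \<in> A" using nonempty by blast
  then have "ereal (pair_form z a - quad a) \<le> fitzpatrick A z"
    unfolding fitzpatrick_eq_SUP by (rule SUP_upper)
  then show ?thesis by auto
qed

lemma F_neq_MInf: "F z \<noteq> -\<infinity>"
  using fitzpatrick_neq_MInf[of z] by (simp add: restricted_fitzpatrick_def convex_indicator_def)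

lemma mem_epi_F:
  "(z, r) \<in> epi F \<longleftrightarrow> fst z \<in> D \<and> (\<forall>a\<in>A. pair_form z a \<le> r + quad a)"
proof (cases "fst z \<in> D")
  case True
  then have "F z = fitzpatrick A z"
    by (simp add: restricted_fitzpatrick_def convex_indicator_def mem_Times_iff)
  then show ?thesis using True by (simp add: epi_def fitzpatrick_eq_SUP SUP_le_iff algebra_simps)
next
  case False
  then show ?thesis using fitzpatrick_neq_MInf[of z]
    by (simp add: epi_def restricted_fitzpatrick_def convex_indicator_def mem_Times_iff)
qed

lemma graph_mem_epi: "a \<in> A \<Longrightarrow> (a, quad a) \<in> epi F"
  using monotone fst_mem_D by (fastforce simp: mem_epi_F monotone_quad quad_diff)

lemma graph_mem_polar: "a \<in> A \<Longrightarrow> (a, quad a) \<in> polar_epi (epi F)"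
  by (rule polar_epiI) (simp add: mem_epi_F sym[of a] add.commute)

lemma convex_epi_F: "convex (epi F)"
proof -
  have "epi F = polar_epi ((\<lambda>a. (a, quad a)) ` A) \<inter> fst -` (fst -` D)"
    by (auto simp: mem_epi_F polar_epi_def)
  moreover have "convex (fst -` (fst -` D) :: (('a \<times> 'a dual) \<times> real) set)"
    by (intro convex_linear_vimage linear_fst D_convex)
  ultimately show ?thesis by (simp add: convex_Int convex_polar_epi)
qed

lemma tilt_pairing: "pair_form z (a + (0, t *\<^sub>R \<phi>)) = pair_form z a + t * pairing \<phi> (fst z)"
  by (simp add: pair_form_def blinfun.bilinear_simps)

text \<open>
  The hypothesis bounds the added term \<open>t \<phi>\<close> by \<open>t s\<close> at every point of \<open>D\<close>.
  Both epigraphs test only such points: that of the Fitzpatrick function tests against \<open>A\<close>, and its polar tests against points above \<open>D\<close>.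
\<close>

lemma tilted_graph_mem:
  assumes "a \<in> A" "0 \<le> t" "\<And>y. y \<in> D \<Longrightarrow> pairing \<phi> y \<le> s"
  shows "(a + (0, t *\<^sub>R \<phi>), quad a + t * s) \<in> epi F \<inter> polar_epi (epi F)"
proof
  show "(a + (0, t *\<^sub>R \<phi>), quad a + t * s) \<in> epi F"
    unfolding mem_epi_F
  proof (intro conjI ballI)
    show "fst (a + (0, t *\<^sub>R \<phi>)) \<in> D" using fst_mem_D[OF assms(1)] by simp
    fix c assume c: "c \<in> A"
    have "pair_form c a \<le> quad a + quad c"
      using graph_mem_epi[OF assms(1)] c by (simp add: mem_epi_F sym[of c])
    moreover have "t * pairing \<phi> (fst c) \<le> t * s"
      using assms fst_mem_D[OF c] by (intro mult_left_mono) auto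
    ultimately show "pair_form (a + (0, t *\<^sub>R \<phi>)) c \<le> quad a + t * s + quad c"
      unfolding sym[of "a + (0, t *\<^sub>R \<phi>)" c] tilt_pairing by simp
  qed
  show "(a + (0, t *\<^sub>R \<phi>), quad a + t * s) \<in> polar_epi (epi F)"
  proof (rule polar_epiI)
    fix w r assume w: "(w, r) \<in> epi F"
    have "t * pairing \<phi> (fst w) \<le> t * s"
      using assms w by (intro mult_left_mono) (auto simp: mem_epi_F)
    moreover have "pair_form w a \<le> r + quad a" using w assms(1) by (simp add: mem_epi_F)
    ultimately show "pair_form (a + (0, t *\<^sub>R \<phi>)) w \<le> quad a + t * s + r"
      unfolding sym[of "a + (0, t *\<^sub>R \<phi>)" w] tilt_pairing by simp
  qed
qed

text \<open>
  If the first component of \<open>z\<close> were outside \<open>D\<close>, then testing \<open>z\<close> against the tilted points of a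
  separating functional would give inequalities that fail for large \<open>t\<close>. The set \<open>H\<close> is arbitrary so
  that the argument covers both the domain of the conjugate and that of the biconjugate.
\<close>

lemma polar_domain:
  assumes z: "(z, r) \<in> polar_epi H" and H: "epi F \<inter> polar_epi (epi F) \<subseteq> H"
  shows "fst z \<in> D"
proof (rule ccontr)
  assume "fst z \<notin> D"
  then obtain \<phi> :: "'a dual" and s where \<phi>: "\<And>y. y \<in> D \<Longrightarrow> \<phi> y \<le> s" "s < \<phi> (fst z)"
    using separate_point_closed_convex[OF D_convex D_closed] by blast
  obtain a where a: "a \<in> A" using nonempty by blast
  define gap where "gap = \<phi> (fst z) - s"
  define t where "t = (\<bar>r + quad a - pair_form z a\<bar> + 1) / gap"
  have gap: "0 < gap" using \<phi>(2) by (simp add: gap_def)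
  then have t: "0 \<le> t" "t * gap = \<bar>r + quad a - pair_form z a\<bar> + 1" by (auto simp: t_def)
  have "(a + (0, t *\<^sub>R \<phi>), quad a + t * s) \<in> H"
    using tilted_graph_mem[OF a t(1) \<phi>(1)] H by blast
  from polar_epiD[OF z this] have "pair_form z a + t * gap \<le> r + quad a"
    by (simp add: tilt_pairing gap_def algebra_simps)
  then show False using t(2) by linarith
qed

text \<open>
  The Fitzpatrick function is a supremum of affine functions coming from points of the conjugate's
  epigraph, so the biconjugate recovers it over \<open>D\<close>; outside \<open>D\<close> the biconjugate is infinite.
\<close>

lemma bipolar_epi_F: "polar_epi (polar_epi (epi F)) \<subseteq> epi F"
proof clarify
  fix x v r assume mem: "((x, v), r) \<in> polar_epi (polar_epi (epi F))"
  then have "x \<in> D" using polar_domain by fastforce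
  then show "((x, v), r) \<in> epi F"
    using polar_epiD[OF mem graph_mem_polar] by (simp add: mem_epi_F)
qed

abbreviation K where "K \<equiv> average_epi (epi F)"

lemma epi_F_nonempty: "epi F \<noteq> {}"
  using nonempty graph_mem_epi by blast

lemma K_self_polar: "K = polar_epi K" and K_nonempty: "K \<noteq> {}"
  using average_epi_self_polar[OF convex_epi_F epi_F_nonempty _ bipolar_epi_F]
    nonempty graph_mem_polar by blast+

lemma kernel_average_F_attained: "kernel_average \<psi> F z \<in> kernel_average_values \<psi> F z"
  by (rule kernel_average_attained[OF F_neq_MInf epi_F_nonempty K_self_polar K_nonempty])

lemma contact_set_F: "contact_set (kernel_average \<psi> F) = contact K"
  by (rule contact_set_kernel_average[OF F_neq_MInf epi_F_nonempty K_self_polar K_nonempty])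

text \<open>
  For \<open>a \<in> A\<close> the choice \<open>z1 = z2 = a\<close> gives the value \<open>quad a\<close>, since the kernel vanishes at \<open>0\<close>.
\<close>

lemma contact_extends: "A \<subseteq> contact K"
proof
  fix a assume a: "a \<in> A"
  have "((1/2) *\<^sub>R (a + a), quad a) \<in> K"
    by (rule average_epiI[OF graph_mem_epi[OF a] graph_mem_polar[OF a]]) (simp add: kernel_zero)
  moreover have "(1/2) *\<^sub>R (a + a) = a" by (simp add: scaleR_2[symmetric])
  ultimately show "a \<in> contact K" by (simp add: contact_def)
qed

lemma contact_maximal_monotone: "maximal_monotone_op (contact K)"
  unfolding maximal_monotone_op_def
proof (intro conjI allI impI)
  show "monotone_op (contact K)"
    unfolding monotone_quad using contact_monotone K_self_polar by blast
next
  fix B assume B: "monotone_op B \<and> contact K \<subseteq> B"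
  have "B \<subseteq> contact K"
    using contact_maximal[OF K_self_polar K_nonempty] B unfolding monotone_quad by blast
  then show "B = contact K" using B by blast
qed

text \<open>
  Both halves of the decomposition that realises a contact point lie above \<open>D\<close>, which is convex.
\<close>

lemma contact_domain: "op_domain (contact K) \<subseteq> D"
proof
  fix x assume "x \<in> op_domain (contact K)"
  then obtain v where "((x, v), quad (x, v)) \<in> K" by (auto simp: op_domain_def contact_def)
  then obtain z1 r1 z2 r2 where *: "(z1, r1) \<in> epi F" "(z2, r2) \<in> polar_epi (epi F)"
    "(x, v) = (1/2) *\<^sub>R (z1 + z2)" by (rule average_epiE)
  have "fst z1 \<in> D" using *(1) by (simp add: mem_epi_F)
  moreover have "fst z2 \<in> D" using *(2) by (rule polar_domain) blast
  ultimately have "(1/2) *\<^sub>R fst z1 + (1/2) *\<^sub>R fst z2 \<in> D" by (intro convexD[OF D_convex]) auto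
  moreover have "x = (1/2) *\<^sub>R fst z1 + (1/2) *\<^sub>R fst z2"
    using arg_cong[OF *(3), of fst] by (simp add: scaleR_add_right)
  ultimately show "x \<in> D" by simp
qed

end

section \<open>Invariance under the group\<close>

locale reflexive_kernel_invariant = reflexive_kernel_operator \<psi> A
  for \<psi> :: "'a::banach \<times> 'a dual \<Rightarrow> real" and A +
  fixes G :: "('a \<times> 'a dual \<Rightarrow> 'a \<times> 'a dual) set"
  assumes iso_group: "bounded_linear_iso_group G"
    and product_map: "\<And>T. T \<in> G \<Longrightarrow> \<exists>U U'. T = map_prod U U'"
    and pairing_invariant: "\<And>U U' x v. map_prod U U' \<in> G \<Longrightarrow> pairing (U' v) (U x) = pairing v x"
    and kernel_invariant: "\<And>U U' x v. map_prod U U' \<in> G \<Longrightarrow> \<psi> (U x, U' v) = \<psi> (x, v)"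
    and operator_invariant: "invariant_set G A"
begin

lemma group_linear: "T \<in> G \<Longrightarrow> bounded_linear T"
  and group_inv: "T \<in> G \<Longrightarrow> inv T \<in> G"
  and group_right_inv: "T \<in> G \<Longrightarrow> T (inv T z) = z"
  using iso_group unfolding bounded_linear_iso_group_def
  by (auto simp: bij_is_surj surj_f_inv_f)

lemma group_pair_form: "T \<in> G \<Longrightarrow> pair_form (T z) (T w) = pair_form z w"
  using product_map[of T] pairing_invariant by (auto simp: pair_form_def)

lemma group_kernel: "T \<in> G \<Longrightarrow> \<psi> (T z) = \<psi> z"
  using product_map[of T] kernel_invariant by (cases z) auto

lemma group_domain:
  assumes T: "T \<in> G" and z: "fst z \<in> D"
  shows "fst (T z) \<in> D"
proof -
  obtain U U' where T': "T = map_prod U U'" using product_map[OF T] by blast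
  have "bounded_linear (\<lambda>x. fst (T (x, 0)))"
    by (intro bounded_linear_compose[OF bounded_linear_fst] bounded_linear_compose[OF group_linear[OF T]]
        bounded_linear_Pair bounded_linear_ident bounded_linear_zero)
  then have U: "bounded_linear U" by (simp add: T')
  have "U ` op_domain A \<subseteq> op_domain A"
  proof clarify
    fix x assume "x \<in> op_domain A"
    then obtain v where "(x, v) \<in> A" by (auto simp: op_domain_def)
    then have "T (x, v) \<in> A" using operator_invariant T by (auto simp: invariant_set_def)
    then show "U x \<in> op_domain A" by (force simp: T' op_domain_def)
  qed
  then have "U ` (convex hull (op_domain A)) \<subseteq> convex hull (op_domain A)"
    using convex_hull_linear_image[OF bounded_linear.linear[OF U]] hull_mono by metis
  then have "U ` D \<subseteq> D"
    unfolding closed_convex_hull_def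
    by (intro image_closure_subset linear_continuous_on[OF U]) (auto simp: image_subset_iff intro: subsetD[OF closure_subset])
  then show ?thesis using z by (auto simp: T')
qed

lemma group_epi:
  assumes T: "T \<in> G" and z: "(z, r) \<in> epi F"
  shows "(T z, r) \<in> epi F"
  unfolding mem_epi_F
proof (intro conjI ballI)
  show "fst (T z) \<in> D" using group_domain[OF T] z by (simp add: mem_epi_F)
  fix a assume a: "a \<in> A"
  have "inv T a \<in> A" using operator_invariant group_inv[OF T] a by (auto simp: invariant_set_def)
  then have "pair_form z (inv T a) \<le> r + quad (inv T a)" using z by (simp add: mem_epi_F)
  then show "pair_form (T z) a \<le> r + quad a"
    using group_pair_form[OF T, of z "inv T a"] group_pair_form[OF T, of "inv T a" "inv T a"]
    by (simp add: quad_def group_right_inv[OF T])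
qed

text \<open>
  Preservation of the epigraph by \<open>T\<close> gives one inequality; the same for the inverse of \<open>T\<close> gives the other.
\<close>

lemma F_invariant: "invariant_fun G F"
  unfolding invariant_fun_def
proof (intro ballI ext)
  fix T z assume T: "T \<in> G"
  have le: "F (S w) \<le> F w" if "S \<in> G" for S w
    by (rule ereal_le_real) (use group_epi[OF that] in \<open>auto simp: epi_def\<close>)
  have "F (inv T (T z)) \<le> F (T z)" by (rule le[OF group_inv[OF T]])
  moreover have "inv T (T z) = z"
    using iso_group T by (simp add: bounded_linear_iso_group_def bij_is_inj)
  ultimately show "(F \<circ> T) z = F z" using le[OF T, of z] by simp
qed

lemma contact_invariant: "invariant_set G (contact K)"
  unfolding invariant_set_def
proof (intro ballI)
  fix T z assume T: "T \<in> G" and z: "z \<in> contact K"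
  have "(T z, quad z) \<in> K"
  proof (rule average_epi_invariant[of T])
    show "linear T" using group_linear[OF T] by (rule bounded_linear.linear)
    show "\<exists>w'. w = T w' \<and> (w', s) \<in> epi F" if "(w, s) \<in> epi F" for w s
      using group_right_inv[OF T] group_epi[OF group_inv[OF T] that] by metis
  qed (use T z group_pair_form group_kernel group_epi in \<open>auto simp: contact_def\<close>)
  then show "T z \<in> contact K" using group_pair_form[OF T] by (simp add: contact_def quad_def)
qed

end

theorem theorem2p6:
  fixes \<psi> :: "'a::banach \<times> 'a dual \<Rightarrow> real"
    and G :: "('a \<times> 'a dual \<Rightarrow> 'a \<times> 'a dual) set"
    and A :: "('a \<times> 'a dual) set"
  assumes "reflexive_space TYPE('a)"
    and "self_dual_kernel \<psi>"
    and "bounded_linear_iso_group G"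
    and "\<And>T. T \<in> G \<Longrightarrow> \<exists>U U'. T = map_prod U U'"
    and "\<And>U U' x v. map_prod U U' \<in> G \<Longrightarrow> pairing (U' v) (U x) = pairing v x"
    and "\<And>U U' x v. map_prod U U' \<in> G \<Longrightarrow> \<psi> (U x, U' v) = \<psi> (x, v)"
    and "A \<noteq> {}"
    and "invariant_set G A"
    and "monotone_op A"
  shows "invariant_fun G (restricted_fitzpatrick A) \<and>
    (\<forall>z. kernel_average \<psi> (restricted_fitzpatrick A) z
            \<in> kernel_average_values \<psi> (restricted_fitzpatrick A) z) \<and>
    (let A' = contact_set (kernel_average \<psi> (restricted_fitzpatrick A))
     in invariant_set G A' \<and> maximal_monotone_op A' \<and> A \<subseteq> A' \<and>
        op_domain A' \<subseteq> closed_convex_hull (op_domain A))"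
proof -
  interpret reflexive_kernel_invariant \<psi> A G
    by unfold_locales (use assms in auto)
  show ?thesis
    unfolding Let_def contact_set_F
    using F_invariant kernel_average_F_attained contact_invariant contact_maximal_monotone
      contact_extends contact_domain by blast
qed

end
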